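(* Let $\mathcal H$ be a real Hilbert space, let $\beta\in\left]0,+\infty\right[$, let $B\colon\mathcal H\to\mathcal H$ be $\beta$-cocoercive, let $C$ be a nonempty bounded closed convex subset of $\mathcal H$ with projection $P_C$, and assume that the variational inequality: find $\overline w\in C$ such that $\langle B\overline w\mid\overline w-w\rangle\le0$ for all $w\in C$, has at least one solution. Let $(\gamma_t)_{t\in\mathbb N^*}$ be a sequence in $\left]0,+\infty\right[$, let $(\lambda_t)_{t\in\mathbb N^*}$ be a sequence in $[0,1]$, let $(\mathfrak B_t)_{t\in\mathbb N^*}$ be an $\mathcal H$-valued random process with $\mathbb E[\|\mathfrak B_t\|^2]<+\infty$ for every $t\in\mathbb N^*$, let $w_1$ be an $\mathcal H$-valued random variable with $\mathbb E[\|w_1\|^2]<+\infty$, and for every $t\in\mathbb N^*$ set $$z_t=w_t-\gamma_t\mathfrak B_t,\qquad y_t=P_Cz_t,\qquad w_{t+1}=(1-\lambda_t)w_t+\lambda_ty_t,$$ and, for $n\in\mathbb N^*$ (with $\sum_{t=1}^n\gamma_t\lambda_t>0$), $$\overline w_n=\Big(\sum_{t=1}^n\gamma_t\lambda_tw_t\Big)\Big/\sum_{t=1}^n\gamma_t\lambda_t .$$ Let $\mathcal F_t=\sigma(w_1,\ldots,w_t)$. Suppose that there exist $(\alpha_t)_{t\in\mathbb N^*}$ in $\left]0,+\infty\right[$, $\sigma\in\left]0,+\infty\right[$ and $\varepsilon\in\left]0,+\infty\right[$ such that, for every $t\in\mathbb N^*$, $$\mathbb E[\mathfrak B_t\mid\mathcal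 F_t]=Bw_t,\qquad \mathbb E[\|\mathfrak B_t-Bw_t\|^2\mid\mathcal F_t]\le\sigma^2(1+\alpha_t\|Bw_t\|^2),\qquad \gamma_t\le\frac{(2-\varepsilon)\beta}{1+2\sigma^2\alpha_t}.$$ For $u\in\mathcal H$ let $V(u)=\sup_{w\in C}\langle Bw\mid u-w\rangle$, and set $$\theta_0=\sup_{u\in C}\tfrac12\mathbb E[\|w_1-u\|^2],\qquad \theta_{1,n}=\frac12\sum_{t=1}^n\Big(\lambda_t\gamma_t^2(1+\sigma^2\alpha_t)\mathbb E[\|Bw_t\|^2]+\sigma^2\lambda_t\gamma_t^2\Big).$$ Then $$V(\mathbb E[\overline w_n])\le(\theta_0+\theta_{1,n})\Big(\sum_{t=1}^n\lambda_t\gamma_t\Big)^{-1}.$$ Moreover, suppose in addition that, for a solution $\overline w$ of the variational inequality, $\sum_{t\in\mathbb N^*}\lambda_t\gamma_t=+\infty$ and $\sum_{t\in\mathbb N^*}\lambda_t\gamma_t^2(1+2\alpha_t\|B\overline w\|^2)<+\infty$. Then $\lim_{n\to+\infty}V(\mathbb E[\overline w_n])=0$. In particular, if $\lambda_t=1$ and $\gamma_t=t^{-\theta}$ for every $t\in\mathbb N^*$, for some $\theta\in\left]1/2,1\right[$, then $V(\mathbb E[\overline w_n])=O(n^{\theta-1})$.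
   Context: All random variables are defined on a fixed probability space; $\mathbb N^*=\mathbb N\setminus\{0\}$; $\mathcal H$ carries its Borel $\sigma$-algebra; $\langle\cdot\mid\cdot\rangle$ and $\|\cdot\|$ are the scalar product and norm of $\mathcal H$; $\sigma(w_1,\dots,w_t)$ is the $\sigma$-algebra generated by $w_1,\dots,w_t$. A random process is a sequence of integrable $\mathcal H$-valued random variables. $B\colon\mathcal H\to\mathcal H$ is $\beta$-cocoercive if $\langle w-y\mid Bw-By\rangle\ge\beta\|Bw-By\|^2$ for all $w,y\in\mathcal H$. No further monotonicity is imposed on $B$. *)

theory Defs
  imports "HOL-Probability.Probability" "HOL-Library.Landau_Symbols"
begin

(* The library's Bochner integral is only declared for second countable spaces. The notions
   below repeat its definition without that class, so that the Hilbert space need not be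
   separable; for second countable spaces they agree with the library's (see the lemmas). A random
   variable is a pointwise limit of simple functions, i.e. Borel measurable with separable range;
   Borel measurability alone is not preserved by sums in a nonseparable space. *)

definition strongly_measurable :: "'b measure \<Rightarrow> ('b \<Rightarrow> 'a::real_normed_vector) \<Rightarrow> bool" where
  "strongly_measurable M f \<longleftrightarrow>
    (\<exists>s. (\<forall>i::nat. simple_function M (s i)) \<and> (\<forall>\<omega>\<in>space M. (\<lambda>i. s i \<omega>) \<longlonglongrightarrow> f \<omega>))"

definition has_expectation :: "'b measure \<Rightarrow> ('b \<Rightarrow> 'a::real_normed_vector) \<Rightarrow> 'a \<Rightarrow> bool" where
  "has_expectation M f m \<longleftrightarrow> strongly_measurable M f \<and>
    (\<exists>s. (\<forall>i::nat. Bochner_Integration.simple_bochner_integrable M (s i)) \<and>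
         (\<lambda>i. \<integral>\<^sup>+\<omega>. norm (f \<omega> - s i \<omega>) \<partial>M) \<longlonglongrightarrow> 0 \<and>
         (\<lambda>i. Bochner_Integration.simple_bochner_integral M (s i)) \<longlonglongrightarrow> m)"

definition bochner_integrable :: "'b measure \<Rightarrow> ('b \<Rightarrow> 'a::real_normed_vector) \<Rightarrow> bool" where
  "bochner_integrable M f \<longleftrightarrow> (\<exists>m. has_expectation M f m)"

definition bochner_expectation :: "'b measure \<Rightarrow> ('b \<Rightarrow> 'a::real_normed_vector) \<Rightarrow> 'a" where
  "bochner_expectation M f =
    (if bochner_integrable M f then THE m. has_expectation M f m else 0)"

lemma strongly_measurable_iff_borel_measurable:
  fixes f :: "'b \<Rightarrow> 'a::{real_normed_vector, second_countable_topology}"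
  shows "strongly_measurable M f \<longleftrightarrow> f \<in> borel_measurable M"
proof
  assume "strongly_measurable M f"
  then obtain s where s: "\<And>i::nat. simple_function M (s i)"
    "\<And>\<omega>. \<omega> \<in> space M \<Longrightarrow> (\<lambda>i. s i \<omega>) \<longlonglongrightarrow> f \<omega>"
    unfolding strongly_measurable_def by blast
  show "f \<in> borel_measurable M"
    by (rule borel_measurable_LIMSEQ_metric[OF borel_measurable_simple_function[OF s(1)] s(2)])
next
  assume "f \<in> borel_measurable M"
  from borel_measurable_implies_sequence_metric[OF this, of 0]
  show "strongly_measurable M f"
    unfolding strongly_measurable_def by blast
qed

lemma has_expectation_iff_has_bochner_integral:
  fixes f :: "'b \<Rightarrow> 'a::{real_normed_vector, second_countable_topology}"
  shows "has_expectation M f m \<longleftrightarrow> has_bochner_integral M f m"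
  unfolding has_expectation_def has_bochner_integral.simps strongly_measurable_iff_borel_measurable
  by blast

lemma bochner_integrable_iff_integrable:
  fixes f :: "'b \<Rightarrow> 'a::{real_normed_vector, second_countable_topology}"
  shows "bochner_integrable M f \<longleftrightarrow> integrable M f"
  unfolding bochner_integrable_def has_expectation_iff_has_bochner_integral integrable.simps
  by simp

lemma bochner_expectation_eq_integral:
  fixes f :: "'b \<Rightarrow> 'a::{real_normed_vector, second_countable_topology}"
  shows "bochner_expectation M f = integral\<^sup>L M f"
  unfolding bochner_expectation_def bochner_integrable_def lebesgue_integral_def
    has_expectation_iff_has_bochner_integral ..

(* Y is a version of E[X | F]; the library's conditional expectation is real-valued only. *)
definition is_cond_expectation ::
  "'b measure \<Rightarrow> 'b measure \<Rightarrow> ('b \<Rightarrow> 'a::real_normed_vector) \<Rightarrow> ('b \<Rightarrow> 'a) \<Rightarrow> bool" where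
  "is_cond_expectation M F X Y \<longleftrightarrow>
    subalgebra M F \<and> Y \<in> borel_measurable F \<and> bochner_integrable M X \<and> bochner_integrable M Y \<and>
    (\<forall>A\<in>sets F. bochner_expectation M (\<lambda>\<omega>. indicat_real A \<omega> *\<^sub>R Y \<omega>) =
                bochner_expectation M (\<lambda>\<omega>. indicat_real A \<omega> *\<^sub>R X \<omega>))"

definition generated_algebra ::
  "'b measure \<Rightarrow> (nat \<Rightarrow> 'b \<Rightarrow> 'a::topological_space) \<Rightarrow> nat \<Rightarrow> 'b measure" where
  "generated_algebra M w t =
    sigma (space M) {w i -` A \<inter> space M | i A. i \<in> {1..t} \<and> A \<in> sets borel}"

definition cocoercive :: "real \<Rightarrow> ('a::real_inner \<Rightarrow> 'a) \<Rightarrow> bool" where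
  "cocoercive \<beta> B \<longleftrightarrow> (\<forall>w y. inner (w - y) (B w - B y) \<ge> \<beta> * (norm (B w - B y))\<^sup>2)"

(* The library's closest_point requires a locally compact space. *)
definition projection_onto :: "'a::real_inner set \<Rightarrow> 'a \<Rightarrow> 'a" where
  "projection_onto C x = (THE p. p \<in> C \<and> (\<forall>y\<in>C. dist x p \<le> dist x y))"

definition vi_solution :: "('a::real_inner \<Rightarrow> 'a) \<Rightarrow> 'a set \<Rightarrow> 'a \<Rightarrow> bool" where
  "vi_solution B C v \<longleftrightarrow> v \<in> C \<and> (\<forall>w\<in>C. inner (B v) (v - w) \<le> 0)"

(* A supremum in the reals: the set is bounded above when C is bounded and B is cocoercive
   (hence Lipschitz). *)
definition vi_gap :: "('a::real_inner \<Rightarrow> 'a) \<Rightarrow> 'a set \<Rightarrow> 'a \<Rightarrow> real" where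
  "vi_gap B C u = (SUP w\<in>C. inner (B w) (u - w))"

end

theory Submission
  imports Defs
begin

text \<open>Fix a point \<open>u \<in> C\<close> and a vector \<open>b\<close> with \<open>\<langle>b | c - u\<rangle> \<ge> 0\<close> on \<open>C\<close>. Then \<open>u\<close> is the projection of
\<open>u - \<gamma> b\<close>, so that nonexpansiveness of the projection compares \<open>w\<^sub>t\<^sub>+\<^sub>1\<close> with \<open>u\<close>. The error
\<open>\<BB>\<^sub>t - B w\<^sub>t\<close> is orthogonal in the mean to every square integrable \<open>H\<close>-valued function of the past
(lemma \<open>cond_expectation_error_orthogonal\<close>), hence the cross terms disappear on taking expectations
and only the variance bound remains: this is \<open>expected_step\<close>. It is used twice.

For \<open>b = 0\<close> and arbitrary \<open>u \<in> C\<close>, monotonicity gives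
\<open>\<langle>B u | w\<^sub>t - u\<rangle> \<le> \<langle>B w\<^sub>t | w\<^sub>t - u\<rangle>\<close>, and the inequalities telescope to the upper bound for the gap
(\<open>telescoped_gap\<close>, \<open>gap_upper_bound\<close>).

For a solution \<open>v\<close> and \<open>b = B v\<close>, cocoercivity and the bound on the step sizes leave a negative term
\<open>- \<epsilon> \<beta> \<lambda>\<^sub>t \<gamma>\<^sub>t E \<parallel>B w\<^sub>t - B v\<parallel>\<^sup>2\<close>. Under the summability hypothesis these terms therefore have a finite sum, which bounds the noise
contributions uniformly in \<open>n\<close> (\<open>noise_budget_bounded\<close>).

The starting point may lie outside \<open>C\<close>, and then the gap at the mean of an average may be negative. A
lower bound is therefore needed for the limit and for the rate. The gap at \<open>x\<close> is at least
\<open>- L d(x, C)\<close>. Each step contracts the distance to \<open>C\<close> at least by the factor \<open>1 - \<lambda>\<^sub>t\<close>, and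
\<open>\<Sum>\<^sub>t \<lambda>\<^sub>t \<Prod>\<^sub>s\<^sub><\<^sub>t (1 - \<lambda>\<^sub>s)\<close> telescopes to at most \<open>1\<close>; as the step sizes are bounded, the distance of the
mean to \<open>C\<close> is at most a constant over \<open>\<Sum>\<^sub>t \<lambda>\<^sub>t \<gamma>\<^sub>t\<close> (\<open>mean_average_near_C\<close>). So the absolute value
of the gap is at most a constant over this sum (\<open>gap_rate\<close>), which gives the limit, and the
rate because \<open>\<Sum>\<^sub>t\<^sub>\<le>\<^sub>n t powr (- \<theta>) \<ge> n powr (1 - \<theta>)\<close>.
\<close>

section \<open>Strongly measurable functions and the Bochner expectation\<close>

text \<open>Both functions are approximated by simple functions, and continuity passes the approximation on to
the composition. Borel measurability would not suffice here: on a nonseparable space the Borel sets of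
the product need not be generated by the rectangles.\<close>
lemma strongly_measurable_compose2:
  assumes "strongly_measurable M f" and "strongly_measurable M g"
    and h: "continuous_on UNIV (\<lambda>p. h (fst p) (snd p))"
  shows "strongly_measurable M (\<lambda>\<omega>. h (f \<omega>) (g \<omega>))"
proof -
  obtain s where s: "\<And>i::nat. simple_function M (s i)"
    "\<And>\<omega>. \<omega> \<in> space M \<Longrightarrow> (\<lambda>i. s i \<omega>) \<longlonglongrightarrow> f \<omega>"
    using assms(1) unfolding strongly_measurable_def by blast
  obtain r where r: "\<And>i::nat. simple_function M (r i)"
    "\<And>\<omega>. \<omega> \<in> space M \<Longrightarrow> (\<lambda>i. r i \<omega>) \<longlonglongrightarrow> g \<omega>"
    using assms(2) unfolding strongly_measurable_def by blast
  have "(\<lambda>i. h (s i \<omega>) (r i \<omega>)) \<longlonglongrightarrow> h (f \<omega>) (g \<omega>)" if "\<omega> \<in> space M" for \<omega>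
    using continuous_on_tendsto_compose[OF h tendsto_Pair[OF s(2)[OF that] r(2)[OF that]]]
    by simp
  moreover have "simple_function M (\<lambda>\<omega>. h (s i \<omega>) (r i \<omega>))" for i
    by (rule simple_function_compose2[OF s(1) r(1)])
  ultimately show ?thesis
    unfolding strongly_measurable_def by (intro exI[of _ "\<lambda>i \<omega>. h (s i \<omega>) (r i \<omega>)"]) auto
qed

lemma strongly_measurable_simple: "simple_function M f \<Longrightarrow> strongly_measurable M f"
  unfolding strongly_measurable_def by (intro exI[of _ "\<lambda>_. f"]) auto

lemma strongly_measurable_const: "strongly_measurable M (\<lambda>_. c)"
  by (rule strongly_measurable_simple) simp

lemma strongly_measurable_compose:
  fixes f :: "'b \<Rightarrow> 'a::real_normed_vector"
  assumes "strongly_measurable M f" and "continuous_on UNIV h"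
  shows "strongly_measurable M (\<lambda>\<omega>. h (f \<omega>))"
proof -
  have "continuous_on UNIV (\<lambda>p::'a \<times> 'a. h (fst p))"
    by (rule continuous_on_compose2[OF assms(2) continuous_on_fst[OF continuous_on_id]]) simp
  then show ?thesis
    by (rule strongly_measurable_compose2[OF assms(1) assms(1)])
qed

lemma strongly_measurable_cong:
  assumes "\<And>\<omega>. \<omega> \<in> space M \<Longrightarrow> f \<omega> = g \<omega>"
  shows "strongly_measurable M f \<longleftrightarrow> strongly_measurable M g"
  unfolding strongly_measurable_def using assms by simp

lemma strongly_measurable_add:
  "strongly_measurable M f \<Longrightarrow> strongly_measurable M g \<Longrightarrow> strongly_measurable M (\<lambda>\<omega>. f \<omega> + g \<omega>)"
  by (rule strongly_measurable_compose2) (auto intro!: continuous_intros)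

lemma strongly_measurable_diff:
  "strongly_measurable M f \<Longrightarrow> strongly_measurable M g \<Longrightarrow> strongly_measurable M (\<lambda>\<omega>. f \<omega> - g \<omega>)"
  by (rule strongly_measurable_compose2) (auto intro!: continuous_intros)

lemma strongly_measurable_scaleR:
  "strongly_measurable M f \<Longrightarrow> strongly_measurable M (\<lambda>\<omega>. c *\<^sub>R f \<omega>)"
  by (erule strongly_measurable_compose) (auto intro!: continuous_intros)

lemma strongly_measurable_indicator:
  fixes f :: "'b \<Rightarrow> 'a::real_normed_vector"
  assumes "A \<in> sets M" and "strongly_measurable M f"
  shows "strongly_measurable M (\<lambda>\<omega>. indicat_real A \<omega> *\<^sub>R f \<omega>)"
proof -
  have "strongly_measurable M (indicat_real A)"
    using assms(1) by (intro strongly_measurable_simple simple_function_indicator)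
  moreover have "continuous_on UNIV (\<lambda>p::real \<times> 'a. fst p *\<^sub>R snd p)"
    by (intro continuous_intros)
  ultimately show ?thesis
    using strongly_measurable_compose2[of M "indicat_real A" f scaleR] assms(2) by blast
qed

lemma borel_measurable_norm_strongly_measurable:
  "strongly_measurable M f \<Longrightarrow> (\<lambda>\<omega>. norm (f \<omega>)) \<in> borel_measurable M"
  using strongly_measurable_compose[of M f norm, OF _ continuous_on_norm[OF continuous_on_id]]
  by (simp add: strongly_measurable_iff_borel_measurable)

lemma borel_measurable_inner_strongly_measurable:
  fixes f g :: "'b \<Rightarrow> 'a::real_inner"
  assumes "strongly_measurable M f" and "strongly_measurable M g"
  shows "(\<lambda>\<omega>. inner (f \<omega>) (g \<omega>)) \<in> borel_measurable M"
proof -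
  have "continuous_on UNIV (\<lambda>p::'a \<times> 'a. inner (fst p) (snd p))"
    by (intro continuous_intros)
  from strongly_measurable_compose2[OF assms this] show ?thesis
    by (simp add: strongly_measurable_iff_borel_measurable)
qed

lemma dist_simple_bochner_integral_le:
  assumes f: "strongly_measurable M f"
    and s: "Bochner_Integration.simple_bochner_integrable M s"
    and t: "Bochner_Integration.simple_bochner_integrable M t"
  shows "ennreal (norm (Bochner_Integration.simple_bochner_integral M s
      - Bochner_Integration.simple_bochner_integral M t))
    \<le> (\<integral>\<^sup>+\<omega>. norm (f \<omega> - s \<omega>) \<partial>M) + (\<integral>\<^sup>+\<omega>. norm (f \<omega> - t \<omega>) \<partial>M)"
proof -
  have st: "strongly_measurable M s" "strongly_measurable M t"
    using s t by (auto intro: strongly_measurable_simple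
        elim: Bochner_Integration.simple_bochner_integrable.cases)
  note [measurable] =
    borel_measurable_norm_strongly_measurable[OF strongly_measurable_diff[OF f st(1)]]
    borel_measurable_norm_strongly_measurable[OF strongly_measurable_diff[OF f st(2)]]
  have st': "Bochner_Integration.simple_bochner_integrable M (\<lambda>\<omega>. s \<omega> - t \<omega>)"
    by (rule simple_bochner_integrable_compose2[of "(-)", OF _ s t]) simp
  have "ennreal (norm (Bochner_Integration.simple_bochner_integral M s
      - Bochner_Integration.simple_bochner_integral M t))
    \<le> Bochner_Integration.simple_bochner_integral M (\<lambda>\<omega>. norm (s \<omega> - t \<omega>))"
    using simple_bochner_integral_norm_bound[OF st'] s t
    by (simp add: simple_bochner_integral_diff ennreal_leI)
  also have "\<dots> = (\<integral>\<^sup>+\<omega>. norm (s \<omega> - t \<omega>) \<partial>M)"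
    using simple_bochner_integrable_compose2[of "\<lambda>x y. norm (x - y)" M s t, OF _ s t]
    by (intro simple_bochner_integral_eq_nn_integral) simp_all
  also have "\<dots> \<le> (\<integral>\<^sup>+\<omega>. ennreal (norm (f \<omega> - s \<omega>)) + ennreal (norm (f \<omega> - t \<omega>)) \<partial>M)"
  proof (rule nn_integral_mono)
    fix \<omega>
    have "norm (s \<omega> - t \<omega>) \<le> norm (f \<omega> - s \<omega>) + norm (f \<omega> - t \<omega>)"
      using norm_triangle_ineq4[of "f \<omega> - t \<omega>" "f \<omega> - s \<omega>"] by simp
    then show "ennreal (norm (s \<omega> - t \<omega>))
        \<le> ennreal (norm (f \<omega> - s \<omega>)) + ennreal (norm (f \<omega> - t \<omega>))"
      by (simp flip: ennreal_plus)
  qed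
  also have "\<dots> = (\<integral>\<^sup>+\<omega>. norm (f \<omega> - s \<omega>) \<partial>M) + (\<integral>\<^sup>+\<omega>. norm (f \<omega> - t \<omega>) \<partial>M)"
    by (rule nn_integral_add) auto
  finally show ?thesis .
qed

text \<open>The simple approximants are set to zero where their norm exceeds \<open>2 * norm (f \<omega>)\<close>. They still
converge pointwise and are now dominated, so that they converge in mean. Their integrals form a Cauchy
sequence, and completeness provides the expectation.\<close>
lemma bochner_integrable_if_integrable_norm:
  fixes f :: "'b \<Rightarrow> 'a::{real_normed_vector, complete_space}"
  assumes f: "strongly_measurable M f" and fin: "integrable M (\<lambda>\<omega>. norm (f \<omega>))"
  shows "bochner_integrable M f"
proof -
  obtain s where s: "\<And>i::nat. simple_function M (s i)"
    "\<And>\<omega>. \<omega> \<in> space M \<Longrightarrow> (\<lambda>i. s i \<omega>) \<longlonglongrightarrow> f \<omega>"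
    using f unfolding strongly_measurable_def by blast
  define A where "A i = {\<omega>\<in>space M. norm (s i \<omega>) \<le> 2 * norm (f \<omega>)}" for i
  define r where "r i \<omega> = (if \<omega> \<in> A i then s i \<omega> else 0)" for i \<omega>
  have A: "A i \<in> sets M" for i
  proof -
    note [measurable] = borel_measurable_norm_strongly_measurable[OF f]
      borel_measurable_norm_strongly_measurable[OF strongly_measurable_simple[OF s(1)]]
    show ?thesis unfolding A_def by measurable
  qed
  have r: "simple_function M (r i)" for i
    unfolding r_def using A[of i] sets.sets_into_space[OF A[of i]]
    by (intro simple_function_If_set) (auto simp: s Int_absorb2)
  have r_bound: "norm (r i \<omega>) \<le> 2 * norm (f \<omega>)" for i \<omega>
    by (auto simp: r_def A_def)
  have r_lim: "(\<lambda>i. r i \<omega>) \<longlonglongrightarrow> f \<omega>" if "\<omega> \<in> space M" for \<omega>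
  proof (cases "f \<omega> = 0")
    case True
    then have "r i \<omega> = 0" for i using r_bound[of i \<omega>] by simp
    then show ?thesis using True by simp
  next
    case False
    have "eventually (\<lambda>i. norm (s i \<omega>) < 2 * norm (f \<omega>)) sequentially"
      using False by (intro order_tendstoD(2)[OF tendsto_norm[OF s(2)[OF that]]]) simp
    then have "eventually (\<lambda>i. s i \<omega> = r i \<omega>) sequentially"
      by eventually_elim (use that in \<open>auto simp: r_def A_def\<close>)
    then show ?thesis
      using s(2)[OF that] by (rule Lim_transform_eventually[rotated])
  qed
  have fin': "(\<integral>\<^sup>+\<omega>. norm (f \<omega>) \<partial>M) < \<infinity>"
    using fin by (simp add: integrable_iff_bounded)
  have nf: "(\<lambda>\<omega>. norm (f \<omega>)) \<in> borel_measurable M"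
    by (rule borel_measurable_norm_strongly_measurable[OF f])
  have r_int: "Bochner_Integration.simple_bochner_integrable M (r i)" for i
  proof (rule simple_bochner_integrableI_bounded[OF r])
    have "(\<integral>\<^sup>+\<omega>. norm (r i \<omega>) \<partial>M) \<le> (\<integral>\<^sup>+\<omega>. ennreal (2 * norm (f \<omega>)) \<partial>M)"
      by (intro nn_integral_mono) (simp add: r_bound)
    also have "\<dots> < \<infinity>"
      using fin' nf by (simp add: ennreal_mult nn_integral_cmult ennreal_mult_less_top)
    finally show "(\<integral>\<^sup>+\<omega>. norm (r i \<omega>) \<partial>M) < \<infinity>" .
  qed
  have meas: "(\<lambda>\<omega>. norm (f \<omega> - r i \<omega>)) \<in> borel_measurable M" for i
    by (intro borel_measurable_norm_strongly_measurable strongly_measurable_diff f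
        strongly_measurable_simple r)
  have lim: "(\<lambda>i. \<integral>\<^sup>+\<omega>. norm (f \<omega> - r i \<omega>) \<partial>M) \<longlonglongrightarrow> 0"
  proof -
    have "(\<lambda>i. \<integral>\<^sup>+\<omega>. norm (f \<omega> - r i \<omega>) \<partial>M) \<longlonglongrightarrow> (\<integral>\<^sup>+\<omega>. 0 \<partial>M)"
    proof (rule nn_integral_dominated_convergence[where w = "\<lambda>\<omega>. ennreal (3 * norm (f \<omega>))"])
      show "AE \<omega> in M. ennreal (norm (f \<omega> - r i \<omega>)) \<le> ennreal (3 * norm (f \<omega>))" for i
      proof (rule AE_I2)
        fix \<omega>
        show "ennreal (norm (f \<omega> - r i \<omega>)) \<le> ennreal (3 * norm (f \<omega>))"
          using norm_triangle_ineq4[of "f \<omega>" "r i \<omega>"] r_bound[of i \<omega>] by (simp add: ennreal_leI)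
      qed
      show "AE \<omega> in M. (\<lambda>i. ennreal (norm (f \<omega> - r i \<omega>))) \<longlonglongrightarrow> 0"
      proof (rule AE_I2)
        fix \<omega> assume "\<omega> \<in> space M"
        from tendsto_norm_zero[OF LIM_zero[OF r_lim[OF this]]]
        have "(\<lambda>i. norm (f \<omega> - r i \<omega>)) \<longlonglongrightarrow> 0" by (simp add: norm_minus_commute)
        then show "(\<lambda>i. ennreal (norm (f \<omega> - r i \<omega>))) \<longlonglongrightarrow> 0"
          by (metis ennreal_0 tendsto_ennrealI)
      qed
      show "(\<integral>\<^sup>+ \<omega>. ennreal (3 * norm (f \<omega>)) \<partial>M) < \<infinity>"
        using fin' nf by (simp add: ennreal_mult nn_integral_cmult ennreal_mult_less_top)
    qed (use meas nf in auto)
    then show ?thesis by simp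
  qed
  have "Cauchy (\<lambda>i. Bochner_Integration.simple_bochner_integral M (r i))"
  proof (rule metric_CauchyI)
    fix e :: real assume "0 < e"
    then have "eventually (\<lambda>i. (\<integral>\<^sup>+\<omega>. norm (f \<omega> - r i \<omega>) \<partial>M) < ennreal (e / 2)) sequentially"
      using lim by (intro order_tendstoD(2)) auto
    then obtain N where N: "\<And>i. i \<ge> N \<Longrightarrow> (\<integral>\<^sup>+\<omega>. norm (f \<omega> - r i \<omega>) \<partial>M) < ennreal (e / 2)"
      unfolding eventually_sequentially by blast
    show "\<exists>N. \<forall>m\<ge>N. \<forall>n\<ge>N. dist (Bochner_Integration.simple_bochner_integral M (r m))
        (Bochner_Integration.simple_bochner_integral M (r n)) < e"
    proof (intro exI[of _ N] allI impI)
      fix m n assume "m \<ge> N" "n \<ge> N"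
      have "ennreal (norm (Bochner_Integration.simple_bochner_integral M (r m)
          - Bochner_Integration.simple_bochner_integral M (r n))) < ennreal (e / 2) + ennreal (e / 2)"
        by (rule le_less_trans[OF dist_simple_bochner_integral_le[OF f r_int r_int]])
          (intro add_strict_mono N \<open>m \<ge> N\<close> \<open>n \<ge> N\<close>)
      also have "\<dots> = ennreal e"
        using \<open>0 < e\<close> by (simp flip: ennreal_plus)
      finally show "dist (Bochner_Integration.simple_bochner_integral M (r m))
        (Bochner_Integration.simple_bochner_integral M (r n)) < e"
        using \<open>0 < e\<close> by (simp add: dist_norm ennreal_less_iff)
    qed
  qed
  then obtain m where "(\<lambda>i. Bochner_Integration.simple_bochner_integral M (r i)) \<longlonglongrightarrow> m"
    by (auto simp: Cauchy_convergent_iff convergent_def)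
  then show ?thesis
    unfolding bochner_integrable_def has_expectation_def using f r_int lim by blast
qed

text \<open>Expectations in the Hilbert space are handled only through their inner products with fixed vectors,
which are ordinary real integrals. This lemma is the bridge.\<close>
lemma has_expectation_inner:
  fixes f :: "'b \<Rightarrow> 'a::real_inner"
  assumes "has_expectation M f m"
  shows "has_bochner_integral M (\<lambda>\<omega>. inner (f \<omega>) e) (inner m e)"
proof -
  obtain s where f: "strongly_measurable M f"
    and s: "\<And>i::nat. Bochner_Integration.simple_bochner_integrable M (s i)"
    and lim: "(\<lambda>i. \<integral>\<^sup>+\<omega>. norm (f \<omega> - s i \<omega>) \<partial>M) \<longlonglongrightarrow> 0"
      "(\<lambda>i. Bochner_Integration.simple_bochner_integral M (s i)) \<longlonglongrightarrow> m"
    using assms unfolding has_expectation_def by blast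
  have lin: "linear (\<lambda>x. inner x e)"
    by (rule bounded_linear.linear[OF bounded_linear_inner_left])
  show ?thesis
  proof (rule has_bochner_integral.intros[where s = "\<lambda>i \<omega>. inner (s i \<omega>) e"])
    show "(\<lambda>\<omega>. inner (f \<omega>) e) \<in> borel_measurable M"
      by (rule borel_measurable_inner_strongly_measurable[OF f strongly_measurable_const])
    show "Bochner_Integration.simple_bochner_integrable M (\<lambda>\<omega>. inner (s i \<omega>) e)" for i
      by (rule simple_bochner_integrable_compose2[where p = "\<lambda>x y. inner x e", OF _ s s]) simp
    show "(\<lambda>i. Bochner_Integration.simple_bochner_integral M (\<lambda>\<omega>. inner (s i \<omega>) e)) \<longlonglongrightarrow> inner m e"
      by (simp add: simple_bochner_integral_linear[OF lin s] tendsto_inner lim(2))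
    show "(\<lambda>i. \<integral>\<^sup>+\<omega>. ennreal (norm (inner (f \<omega>) e - inner (s i \<omega>) e)) \<partial>M) \<longlonglongrightarrow> 0"
    proof (rule tendsto_sandwich[OF _ _ tendsto_const])
      show "(\<lambda>i. ennreal (norm e) * (\<integral>\<^sup>+\<omega>. norm (f \<omega> - s i \<omega>) \<partial>M)) \<longlonglongrightarrow> 0"
        using ennreal_tendsto_cmult[OF _ lim(1), of "ennreal (norm e)"] by simp
      show "eventually (\<lambda>i. (\<integral>\<^sup>+\<omega>. ennreal (norm (inner (f \<omega>) e - inner (s i \<omega>) e)) \<partial>M)
          \<le> ennreal (norm e) * (\<integral>\<^sup>+\<omega>. norm (f \<omega> - s i \<omega>) \<partial>M)) sequentially"
      proof (rule always_eventually, rule allI)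
        fix i
        have "strongly_measurable M (s i)"
          using s[of i] by (auto intro: strongly_measurable_simple
              elim: Bochner_Integration.simple_bochner_integrable.cases)
        then have "(\<lambda>\<omega>. norm (f \<omega> - s i \<omega>)) \<in> borel_measurable M"
          by (intro borel_measurable_norm_strongly_measurable strongly_measurable_diff f)
        then have "ennreal (norm e) * (\<integral>\<^sup>+\<omega>. norm (f \<omega> - s i \<omega>) \<partial>M)
            = (\<integral>\<^sup>+\<omega>. ennreal (norm e) * norm (f \<omega> - s i \<omega>) \<partial>M)"
          by (intro nn_integral_cmult[symmetric]) simp
        moreover have "norm (inner (f \<omega>) e - inner (s i \<omega>) e) \<le> norm e * norm (f \<omega> - s i \<omega>)" for \<omega>
          using Cauchy_Schwarz_ineq2[of "f \<omega> - s i \<omega>" e] by (simp add: inner_diff_left mult.commute)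
        ultimately show "(\<integral>\<^sup>+\<omega>. ennreal (norm (inner (f \<omega>) e - inner (s i \<omega>) e)) \<partial>M)
          \<le> ennreal (norm e) * (\<integral>\<^sup>+\<omega>. norm (f \<omega> - s i \<omega>) \<partial>M)"
          by (auto intro!: nn_integral_mono simp: ennreal_leI simp flip: ennreal_mult)
      qed
    qed simp
  qed
qed

text \<open>Expectations are unique because their inner products with all vectors are determined.\<close>
lemma has_expectation_bochner_expectation:
  fixes f :: "'b \<Rightarrow> 'a::real_inner"
  assumes "bochner_integrable M f"
  shows "has_expectation M f (bochner_expectation M f)"
proof -
  obtain m where m: "has_expectation M f m"
    using assms unfolding bochner_integrable_def by blast
  have "m' = m" if "has_expectation M f m'" for m'
  proof -
    have "inner m' e = inner m e" for e
      using has_expectation_inner[OF that, of e] has_expectation_inner[OF m, of e]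
      by (rule has_bochner_integral_eq)
    from this[of "m' - m"] have "inner (m' - m) (m' - m) = 0"
      by (simp add: inner_diff_left)
    then show ?thesis by simp
  qed
  then have "(THE m. has_expectation M f m) = m"
    by (intro the_equality m) auto
  then show ?thesis
    using assms m unfolding bochner_expectation_def by simp
qed

lemma
  fixes f :: "'b \<Rightarrow> 'a::real_inner"
  assumes "bochner_integrable M f"
  shows integrable_inner: "integrable M (\<lambda>\<omega>. inner (f \<omega>) e)"
    and inner_bochner_expectation:
      "inner (bochner_expectation M f) e = (\<integral>\<omega>. inner (f \<omega>) e \<partial>M)"
  using has_expectation_inner[OF has_expectation_bochner_expectation[OF assms], of e]
  by (simp_all add: has_bochner_integral_iff)

lemma strongly_measurable_if_bochner_integrable:
  "bochner_integrable M f \<Longrightarrow> strongly_measurable M f"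
  by (auto simp: bochner_integrable_def has_expectation_def)

lemma integrable_norm_if_bochner_integrable:
  fixes f :: "'b \<Rightarrow> 'a::real_normed_vector"
  assumes "bochner_integrable M f"
  shows "integrable M (\<lambda>\<omega>. norm (f \<omega>))"
proof -
  obtain s where f: "strongly_measurable M f"
    and s: "\<And>i::nat. Bochner_Integration.simple_bochner_integrable M (s i)"
    and lim: "(\<lambda>i. \<integral>\<^sup>+\<omega>. norm (f \<omega> - s i \<omega>) \<partial>M) \<longlonglongrightarrow> 0"
    using assms unfolding bochner_integrable_def has_expectation_def by blast
  obtain i where i: "(\<integral>\<^sup>+\<omega>. norm (f \<omega> - s i \<omega>) \<partial>M) < 1"
    using order_tendstoD(2)[OF lim, of 1] by (auto simp: eventually_sequentially)
  have si: "strongly_measurable M (s i)"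
    using s[of i] by (auto intro: strongly_measurable_simple
        elim: Bochner_Integration.simple_bochner_integrable.cases)
  note [measurable] = borel_measurable_norm_strongly_measurable[OF si]
    borel_measurable_norm_strongly_measurable[OF f]
    borel_measurable_norm_strongly_measurable[OF strongly_measurable_diff[OF f si]]
  have "Bochner_Integration.simple_bochner_integrable M (\<lambda>\<omega>. norm (s i \<omega>))"
    by (rule simple_bochner_integrable_compose2[of "\<lambda>x y. norm x", OF _ s s]) simp
  from simple_bochner_integral_eq_nn_integral[OF this, symmetric]
  have s_fin: "(\<integral>\<^sup>+\<omega>. norm (s i \<omega>) \<partial>M) < \<infinity>"
    by simp
  have "(\<integral>\<^sup>+\<omega>. norm (f \<omega>) \<partial>M)
      \<le> (\<integral>\<^sup>+\<omega>. ennreal (norm (f \<omega> - s i \<omega>)) + ennreal (norm (s i \<omega>)) \<partial>M)"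
  proof (rule nn_integral_mono)
    fix \<omega>
    show "ennreal (norm (f \<omega>)) \<le> ennreal (norm (f \<omega> - s i \<omega>)) + ennreal (norm (s i \<omega>))"
      using norm_triangle_ineq[of "f \<omega> - s i \<omega>" "s i \<omega>"] by (simp flip: ennreal_plus)
  qed
  also have "\<dots> = (\<integral>\<^sup>+\<omega>. norm (f \<omega> - s i \<omega>) \<partial>M) + (\<integral>\<^sup>+\<omega>. norm (s i \<omega>) \<partial>M)"
    by (rule nn_integral_add) auto
  also have "\<dots> < \<infinity>"
    using s_fin less_trans[OF i ennreal_one_less_top] by simp
  finally have "(\<integral>\<^sup>+\<omega>. norm (f \<omega>) \<partial>M) < \<infinity>" .
  then show ?thesis
    by (simp add: integrable_iff_bounded)
qed

lemma has_expectation_cong: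
  assumes "\<And>\<omega>. \<omega> \<in> space M \<Longrightarrow> f \<omega> = g \<omega>"
  shows "has_expectation M f m \<longleftrightarrow> has_expectation M g m"
proof -
  have "(\<integral>\<^sup>+\<omega>. norm (f \<omega> - s \<omega>) \<partial>M) = (\<integral>\<^sup>+\<omega>. norm (g \<omega> - s \<omega>) \<partial>M)" for s
    by (rule nn_integral_cong) (simp add: assms)
  then show ?thesis
    unfolding has_expectation_def by (simp add: strongly_measurable_cong[of M f g, OF assms])
qed

lemma bochner_expectation_cong:
  assumes "\<And>\<omega>. \<omega> \<in> space M \<Longrightarrow> f \<omega> = g \<omega>"
  shows "bochner_expectation M f = bochner_expectation M g"
proof -
  have "has_expectation M f = has_expectation M g"
    by (intro ext has_expectation_cong assms)
  then show ?thesis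
    by (simp add: bochner_expectation_def bochner_integrable_def)
qed

section \<open>Square integrable functions\<close>

definition square_integrable :: "'b measure \<Rightarrow> ('b \<Rightarrow> 'a::real_normed_vector) \<Rightarrow> bool" where
  "square_integrable M f \<longleftrightarrow> strongly_measurable M f \<and> integrable M (\<lambda>\<omega>. (norm (f \<omega>))\<^sup>2)"

lemma square_integrable_cong:
  assumes "\<And>\<omega>. \<omega> \<in> space M \<Longrightarrow> f \<omega> = g \<omega>"
  shows "square_integrable M f \<longleftrightarrow> square_integrable M g"
  unfolding square_integrable_def using strongly_measurable_cong[of M f g] assms
  by (simp cong: Bochner_Integration.integrable_cong)

lemma square_integrable_dominated:
  assumes f: "strongly_measurable M f" and g: "square_integrable M g" and M: "finite_measure M"
    and le: "\<And>\<omega>. \<omega> \<in> space M \<Longrightarrow> norm (f \<omega>) \<le> a + b * norm (g \<omega>)"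
  shows "square_integrable M f"
  unfolding square_integrable_def
proof (rule conjI[OF f])
  interpret finite_measure M by fact
  show "integrable M (\<lambda>\<omega>. (norm (f \<omega>))\<^sup>2)"
  proof (rule Bochner_Integration.integrable_bound)
    show "integrable M (\<lambda>\<omega>. 2 * a\<^sup>2 + 2 * b\<^sup>2 * (norm (g \<omega>))\<^sup>2)"
      using g unfolding square_integrable_def by simp
    show "(\<lambda>\<omega>. (norm (f \<omega>))\<^sup>2) \<in> borel_measurable M"
      using borel_measurable_norm_strongly_measurable[OF f] by simp
    show "AE \<omega> in M. norm ((norm (f \<omega>))\<^sup>2) \<le> norm (2 * a\<^sup>2 + 2 * b\<^sup>2 * (norm (g \<omega>))\<^sup>2)"
    proof (rule AE_I2)
      fix \<omega> assume "\<omega> \<in> space M"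
      then have "(norm (f \<omega>))\<^sup>2 \<le> (a + b * norm (g \<omega>))\<^sup>2"
        by (intro power_mono le) auto
      also have "\<dots> \<le> 2 * a\<^sup>2 + 2 * b\<^sup>2 * (norm (g \<omega>))\<^sup>2"
        using sum_squares_bound[of a "b * norm (g \<omega>)"] by (simp add: power2_sum power_mult_distrib)
      finally show "norm ((norm (f \<omega>))\<^sup>2) \<le> norm (2 * a\<^sup>2 + 2 * b\<^sup>2 * (norm (g \<omega>))\<^sup>2)"
        by simp
    qed
  qed
qed

lemma square_integrable_bounded:
  fixes f :: "'b \<Rightarrow> 'a::real_normed_vector"
  assumes "finite_measure M" "strongly_measurable M f"
    and "\<And>\<omega>. \<omega> \<in> space M \<Longrightarrow> norm (f \<omega>) \<le> K"
  shows "square_integrable M f"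
proof (rule square_integrable_dominated[OF assms(2) _ assms(1), of "\<lambda>_. 0 :: 'a" K 0])
  show "square_integrable M (\<lambda>_. 0 :: 'a)"
    by (simp add: square_integrable_def strongly_measurable_const)
qed (use assms(3) in simp)

lemma square_integrable_scaleR:
  "square_integrable M f \<Longrightarrow> square_integrable M (\<lambda>\<omega>. c *\<^sub>R f \<omega>)"
  by (simp add: square_integrable_def strongly_measurable_scaleR power_mult_distrib)

lemma square_integrable_add:
  assumes f: "square_integrable M f" and g: "square_integrable M g"
  shows "square_integrable M (\<lambda>\<omega>. f \<omega> + g \<omega>)"
proof -
  have fg: "strongly_measurable M (\<lambda>\<omega>. f \<omega> + g \<omega>)"
    using f g by (simp add: square_integrable_def strongly_measurable_add)
  have "integrable M (\<lambda>\<omega>. (norm (f \<omega> + g \<omega>))\<^sup>2)"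
  proof (rule Bochner_Integration.integrable_bound)
    show "integrable M (\<lambda>\<omega>. 2 * (norm (f \<omega>))\<^sup>2 + 2 * (norm (g \<omega>))\<^sup>2)"
      using f g unfolding square_integrable_def by simp
    show "(\<lambda>\<omega>. (norm (f \<omega> + g \<omega>))\<^sup>2) \<in> borel_measurable M"
      using borel_measurable_norm_strongly_measurable[OF fg] by simp
    have "(norm (f \<omega> + g \<omega>))\<^sup>2 \<le> 2 * (norm (f \<omega>))\<^sup>2 + 2 * (norm (g \<omega>))\<^sup>2" for \<omega>
      using power_mono[OF norm_triangle_ineq[of "f \<omega>" "g \<omega>"], of 2]
        sum_squares_bound[of "norm (f \<omega>)" "norm (g \<omega>)"] by (simp add: power2_sum)
    then show "AE \<omega> in M. norm ((norm (f \<omega> + g \<omega>))\<^sup>2) \<le> norm (2 * (norm (f \<omega>))\<^sup>2 + 2 * (norm (g \<omega>))\<^sup>2)"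
      by simp
  qed
  with fg show ?thesis by (simp add: square_integrable_def)
qed

lemma square_integrable_diff:
  assumes f: "square_integrable M f" and g: "square_integrable M g"
  shows "square_integrable M (\<lambda>\<omega>. f \<omega> - g \<omega>)"
  using square_integrable_add[OF f square_integrable_scaleR[OF g, of "-1"]] by simp

lemma square_integrable_const:
  "finite_measure M \<Longrightarrow> square_integrable M (\<lambda>_. c)"
  by (rule square_integrable_bounded[where K = "norm c"]) (auto intro: strongly_measurable_const)

lemma integrable_norm_mult_norm:
  assumes f: "square_integrable M f" and g: "square_integrable M g"
  shows "integrable M (\<lambda>\<omega>. norm (f \<omega>) * norm (g \<omega>))"
proof (rule Bochner_Integration.integrable_bound)
  show "integrable M (\<lambda>\<omega>. (norm (f \<omega>))\<^sup>2 + (norm (g \<omega>))\<^sup>2)"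
    using f g unfolding square_integrable_def by simp
  show "(\<lambda>\<omega>. norm (f \<omega>) * norm (g \<omega>)) \<in> borel_measurable M"
    using f g unfolding square_integrable_def
    by (intro borel_measurable_times borel_measurable_norm_strongly_measurable) auto
  have "norm (f \<omega>) * norm (g \<omega>) \<le> (norm (f \<omega>))\<^sup>2 + (norm (g \<omega>))\<^sup>2" for \<omega>
  proof -
    have "0 \<le> norm (f \<omega>) * norm (g \<omega>)" by simp
    then show ?thesis
      using sum_squares_bound[of "norm (f \<omega>)" "norm (g \<omega>)"] by linarith
  qed
  then show "AE \<omega> in M. norm (norm (f \<omega>) * norm (g \<omega>)) \<le> norm ((norm (f \<omega>))\<^sup>2 + (norm (g \<omega>))\<^sup>2)"
    by simp
qed

lemma integrable_inner_if_square_integrable: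
  fixes f g :: "'b \<Rightarrow> 'a::real_inner"
  assumes f: "square_integrable M f" and g: "square_integrable M g"
  shows "integrable M (\<lambda>\<omega>. inner (f \<omega>) (g \<omega>))"
proof (rule Bochner_Integration.integrable_bound[OF integrable_norm_mult_norm[OF f g]])
  show "(\<lambda>\<omega>. inner (f \<omega>) (g \<omega>)) \<in> borel_measurable M"
    using f g by (simp add: square_integrable_def borel_measurable_inner_strongly_measurable)
qed (simp add: Cauchy_Schwarz_ineq2)

lemma integrable_norm_if_square_integrable:
  fixes f :: "'b \<Rightarrow> 'a::real_normed_vector"
  assumes "square_integrable M f" and "finite_measure M"
  shows "integrable M (\<lambda>\<omega>. norm (f \<omega>))"
  using integrable_norm_mult_norm[OF assms(1) square_integrable_const[OF assms(2), of "1::real"]]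
  by simp

section \<open>Orthogonality of the conditional expectation error\<close>

text \<open>A nearest point to \<open>x\<close> among \<open>0\<close> and \<open>d 0, \<dots>, d (n - 1)\<close>. The origin is included in order that the
approximation is dominated by \<open>norm x\<close>. The recursion makes each stage a two-way case distinction on
a measurable event, so that integrals against \<open>nearest d n (W \<omega>)\<close> are accessible by induction on \<open>n\<close>.\<close>
primrec nearest :: "(nat \<Rightarrow> 'a::real_normed_vector) \<Rightarrow> nat \<Rightarrow> 'a \<Rightarrow> 'a" where
  "nearest d 0 x = 0"
| "nearest d (Suc n) x =
    (if norm (x - d n) < norm (x - nearest d n x) then d n else nearest d n x)"

lemma norm_diff_nearest_le_norm: "norm (x - nearest d n x) \<le> norm x"
  by (induction n) auto

lemma norm_nearest_le: "norm (nearest d n x) \<le> 2 * norm x"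
  using norm_triangle_ineq4[of x "x - nearest d n x"] norm_diff_nearest_le_norm[of x d n] by simp

lemma norm_diff_nearest_le: "k < n \<Longrightarrow> norm (x - nearest d n x) \<le> norm (x - d k)"
  by (induction n) (auto simp: less_Suc_eq)

lemma nearest_LIMSEQ:
  assumes "\<And>e. e > 0 \<Longrightarrow> \<exists>k. norm (x - d k) < e"
  shows "(\<lambda>n. nearest d n x) \<longlonglongrightarrow> x"
proof (rule LIMSEQ_I)
  fix e :: real assume "0 < e"
  with assms obtain k where k: "norm (x - d k) < e" by blast
  have "norm (nearest d n x - x) < e" if "n \<ge> Suc k" for n
    using norm_diff_nearest_le[of k n x d] that k by (simp add: norm_minus_commute)
  then show "\<exists>N. \<forall>n\<ge>N. norm (nearest d n x - x) < e" by blast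
qed

text \<open>The distance, unlike the difference of two Borel functions into a nonseparable space, is accessible to
measurability arguments, since it is a minimum of finitely many continuous functions.\<close>
lemma borel_measurable_norm_diff_nearest [measurable]:
  "(\<lambda>x. norm (x - nearest d n x)) \<in> borel_measurable borel"
proof (induction n)
  case 0
  show ?case by (auto intro!: borel_measurable_continuous_onI continuous_intros)
next
  case (Suc n)
  have "(\<lambda>x. norm (x - d n)) \<in> borel_measurable borel"
    by (auto intro!: borel_measurable_continuous_onI continuous_intros)
  from borel_measurable_min[OF Suc this] have "(\<lambda>x. min (norm (x - d n)) (norm (x - nearest d n x))) \<in> borel_measurable borel" .
  then show ?case by (rule back_subst[of "\<lambda>f. f \<in> _"]) auto
qed

text \<open>The values of the simple approximants form a countable set whose closure contains the range.\<close>
lemma strongly_measurable_countable_approx: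
  fixes f :: "'b \<Rightarrow> 'a::real_normed_vector"
  assumes "strongly_measurable M f"
  obtains d :: "nat \<Rightarrow> 'a" where "\<And>\<omega> e. \<omega> \<in> space M \<Longrightarrow> e > 0 \<Longrightarrow> \<exists>k. norm (f \<omega> - d k) < e"
proof -
  obtain s where s: "\<And>i::nat. simple_function M (s i)"
    "\<And>\<omega>. \<omega> \<in> space M \<Longrightarrow> (\<lambda>i. s i \<omega>) \<longlonglongrightarrow> f \<omega>"
    using assms unfolding strongly_measurable_def by blast
  define D where "D = insert 0 (\<Union>i. s i ` space M)"
  have "countable D"
    unfolding D_def using s(1) by (auto simp: simple_function_def intro: countable_finite)
  then have D: "range (from_nat_into D) = D"
    by (intro range_from_nat_into) (auto simp: D_def)
  show thesis
  proof (rule that)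
    fix \<omega> and e :: real assume \<omega>: "\<omega> \<in> space M" and "e > 0"
    then obtain i where "norm (s i \<omega> - f \<omega>) < e"
      using LIMSEQ_D[OF s(2)] by blast
    moreover have "s i \<omega> \<in> range (from_nat_into D)"
      unfolding D using \<omega> by (auto simp: D_def)
    ultimately show "\<exists>k. norm (f \<omega> - from_nat_into D k) < e"
      by (auto simp: norm_minus_commute)
  qed
qed

text \<open>The defining property of the conditional expectation says that \<open>X - Y\<close> is orthogonal to every
constant vector on every event of \<open>F\<close>. By induction on \<open>n\<close> it is orthogonal to the
finitely valued approximation \<open>nearest d n (W \<omega>)\<close> of \<open>W\<close>, and dominated convergence
gives the claim for \<open>W\<close> itself.\<close>
lemma cond_expectation_error_orthogonal:
  fixes X Y W :: "'b \<Rightarrow> 'a::{real_inner, complete_space}"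
  assumes cond: "is_cond_expectation M F X Y"
    and W: "W \<in> borel_measurable F" "strongly_measurable M W"
    and int: "integrable M (\<lambda>\<omega>. norm (X \<omega> - Y \<omega>) * norm (W \<omega>))"
  shows "(\<integral>\<omega>. inner (X \<omega> - Y \<omega>) (W \<omega>) \<partial>M) = 0"
proof -
  have F: "space F = space M" "sets F \<subseteq> sets M"
    and XY: "bochner_integrable M X" "bochner_integrable M Y"
    and eq: "\<And>A. A \<in> sets F \<Longrightarrow> bochner_expectation M (\<lambda>\<omega>. indicat_real A \<omega> *\<^sub>R Y \<omega>) =
                bochner_expectation M (\<lambda>\<omega>. indicat_real A \<omega> *\<^sub>R X \<omega>)"
    using cond unfolding is_cond_expectation_def subalgebra_def by auto
  define Z where "Z \<omega> = X \<omega> - Y \<omega>" for \<omega>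
  have restrict: "bochner_integrable M (\<lambda>\<omega>. indicat_real A \<omega> *\<^sub>R f \<omega>)"
    if f: "bochner_integrable M f" and A: "A \<in> sets F" for A and f :: "'b \<Rightarrow> 'a"
  proof (rule bochner_integrable_if_integrable_norm)
    show "strongly_measurable M (\<lambda>\<omega>. indicat_real A \<omega> *\<^sub>R f \<omega>)"
      using A F f by (intro strongly_measurable_indicator strongly_measurable_if_bochner_integrable) auto
    have "integrable M (\<lambda>\<omega>. indicat_real A \<omega> *\<^sub>R norm (f \<omega>))"
      using A F by (intro integrable_mult_indicator integrable_norm_if_bochner_integrable f) auto
    then show "integrable M (\<lambda>\<omega>. norm (indicat_real A \<omega> *\<^sub>R f \<omega>))"
      by simp
  qed
  have const: "integrable M (\<lambda>\<omega>. indicat_real A \<omega> * inner (Z \<omega>) e)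
      \<and> (\<integral>\<omega>. indicat_real A \<omega> * inner (Z \<omega>) e \<partial>M) = 0" if A: "A \<in> sets F" for A e
  proof -
    note i = integrable_inner[OF restrict[OF XY(1) A], of e] integrable_inner[OF restrict[OF XY(2) A], of e]
    have *: "indicat_real A \<omega> * inner (Z \<omega>) e =
        inner (indicat_real A \<omega> *\<^sub>R X \<omega>) e - inner (indicat_real A \<omega> *\<^sub>R Y \<omega>) e" for \<omega>
      by (simp add: Z_def inner_diff_left algebra_simps)
    show ?thesis
      unfolding *
      by (simp only: Bochner_Integration.integrable_diff[OF i] Bochner_Integration.integral_diff[OF i]
        inner_bochner_expectation[OF restrict[OF XY(1) A], symmetric]
        inner_bochner_expectation[OF restrict[OF XY(2) A], symmetric] eq[OF A]) simp
  qed
  obtain d :: "nat \<Rightarrow> 'a"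
    where d: "\<And>\<omega> e. \<omega> \<in> space M \<Longrightarrow> e > 0 \<Longrightarrow> \<exists>k. norm (W \<omega> - d k) < e"
    using strongly_measurable_countable_approx[OF W(2)] by blast
  have approx: "integrable M (\<lambda>\<omega>. indicat_real A \<omega> * inner (Z \<omega>) (nearest d n (W \<omega>)))
      \<and> (\<integral>\<omega>. indicat_real A \<omega> * inner (Z \<omega>) (nearest d n (W \<omega>)) \<partial>M) = 0"
    if "A \<in> sets F" for A n
    using that
  proof (induction n arbitrary: A)
    case 0
    then show ?case by simp
  next
    case (Suc n)
    define E where "E = {\<omega>\<in>space F. norm (W \<omega> - d n) < norm (W \<omega> - nearest d n (W \<omega>))}"
    have "(\<lambda>x. norm (x - d n)) \<in> borel_measurable borel"
      by (auto intro!: borel_measurable_continuous_onI continuous_intros)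
    note [measurable] = measurable_compose[OF W(1) this]
      measurable_compose[OF W(1) borel_measurable_norm_diff_nearest]
    have "E \<in> sets F" unfolding E_def by measurable
    with Suc.prems have AE: "A \<inter> E \<in> sets F" "A - E \<in> sets F" by auto
    (* On E the point d n is nearer than all earlier candidates; elsewhere the earlier one is kept. *)
    have *: "indicat_real A \<omega> * inner (Z \<omega>) (nearest d (Suc n) (W \<omega>)) =
        indicat_real (A \<inter> E) \<omega> * inner (Z \<omega>) (d n)
        + indicat_real (A - E) \<omega> * inner (Z \<omega>) (nearest d n (W \<omega>))" for \<omega>
      using sets.sets_into_space[OF Suc.prems] by (auto simp: E_def indicator_def)
    note i = conjunct1[OF const[OF AE(1), of "d n"]] conjunct1[OF Suc.IH[OF AE(2)]]
    show ?case
      unfolding *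
      using const[OF AE(1), of "d n"] Suc.IH[OF AE(2)]
      by (simp only: Bochner_Integration.integrable_add[OF i] Bochner_Integration.integral_add[OF i]) simp
  qed
  have space: "space M \<in> sets F" using F(1) sets.top[of F] by simp
  have meas: "(\<lambda>\<omega>. inner (Z \<omega>) (nearest d n (W \<omega>))) \<in> borel_measurable M" for n
  proof -
    have "(\<lambda>\<omega>. indicat_real (space M) \<omega> * inner (Z \<omega>) (nearest d n (W \<omega>))) \<in> borel_measurable M"
      using approx[OF space, of n] by blast
    then show ?thesis by (subst measurable_cong[where g = "\<lambda>\<omega>. indicat_real (space M) \<omega> * inner (Z \<omega>) (nearest d n (W \<omega>))"]) auto
  qed
  have "(\<lambda>n. \<integral>\<omega>. inner (Z \<omega>) (nearest d n (W \<omega>)) \<partial>M) \<longlonglongrightarrow> (\<integral>\<omega>. inner (Z \<omega>) (W \<omega>) \<partial>M)"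
  proof (rule integral_dominated_convergence[where w = "\<lambda>\<omega>. 2 * (norm (X \<omega> - Y \<omega>) * norm (W \<omega>))"])
    show "(\<lambda>\<omega>. inner (Z \<omega>) (W \<omega>)) \<in> borel_measurable M"
      unfolding Z_def using XY W(2)
      by (intro borel_measurable_inner_strongly_measurable strongly_measurable_diff)
        (auto dest: strongly_measurable_if_bochner_integrable)
    show "integrable M (\<lambda>\<omega>. 2 * (norm (X \<omega> - Y \<omega>) * norm (W \<omega>)))"
      using int by simp
    show "AE \<omega> in M. (\<lambda>n. inner (Z \<omega>) (nearest d n (W \<omega>))) \<longlonglongrightarrow> inner (Z \<omega>) (W \<omega>)"
      using d by (intro AE_I2 tendsto_intros nearest_LIMSEQ)
    show "AE \<omega> in M. norm (inner (Z \<omega>) (nearest d n (W \<omega>))) \<le> 2 * (norm (X \<omega> - Y \<omega>) * norm (W \<omega>))" for n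
    proof (rule AE_I2)
      fix \<omega>
      have "norm (inner (Z \<omega>) (nearest d n (W \<omega>))) \<le> norm (Z \<omega>) * norm (nearest d n (W \<omega>))"
        using Cauchy_Schwarz_ineq2 by simp
      also have "\<dots> \<le> norm (Z \<omega>) * (2 * norm (W \<omega>))"
        by (intro mult_left_mono norm_nearest_le) simp
      finally show "norm (inner (Z \<omega>) (nearest d n (W \<omega>))) \<le> 2 * (norm (X \<omega> - Y \<omega>) * norm (W \<omega>))"
        by (simp add: Z_def)
    qed
  qed (rule meas)
  moreover have "(\<integral>\<omega>. inner (Z \<omega>) (nearest d n (W \<omega>)) \<partial>M) = 0" for n
  proof -
    have "(\<integral>\<omega>. inner (Z \<omega>) (nearest d n (W \<omega>)) \<partial>M)
        = (\<integral>\<omega>. indicat_real (space M) \<omega> * inner (Z \<omega>) (nearest d n (W \<omega>)) \<partial>M)"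
      by (intro Bochner_Integration.integral_cong) auto
    then show ?thesis using approx[OF space, of n] by simp
  qed
  ultimately show ?thesis
    by (simp add: Z_def LIMSEQ_const_iff)
qed

section \<open>Projections and cocoercive operators in Hilbert space\<close>

text \<open>A minimizing sequence for the distance is Cauchy by the parallelogram law; its limit is the
projection, as the minimizer is unique by convexity.\<close>
lemma projection_onto_characterization:
  fixes C :: "'a::{real_inner, complete_space} set"
  assumes C: "C \<noteq> {}" "closed C" "convex C"
  shows "projection_onto C x \<in> C" and "c \<in> C \<Longrightarrow> inner (x - projection_onto C x) (c - projection_onto C x) \<le> 0"
proof -
  define d where "d = (INF c\<in>C. dist x c)"
  have bdd: "bdd_below (dist x ` C)" by (rule bdd_belowI[of _ 0]) auto
  have d_le: "d \<le> dist x c" if "c \<in> C" for c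
    unfolding d_def by (rule cINF_lower[OF bdd that])
  have d0: "0 \<le> d" unfolding d_def using C(1) by (intro cINF_greatest) auto
  have "\<exists>c\<in>C. dist x c < d + inverse (real (Suc n))" for n
    using cINF_less_iff[OF C(1) bdd, of "d + inverse (real (Suc n))"] by (simp add: d_def)
  then obtain c where c: "\<And>n. c n \<in> C" "\<And>n. dist x (c n) < d + inverse (real (Suc n))"
    by metis
  have par: "(dist a b)\<^sup>2 \<le> 2 * (dist x a)\<^sup>2 + 2 * (dist x b)\<^sup>2 - 4 * d\<^sup>2"
    if "a \<in> C" "b \<in> C" for a b
  proof -
    (* The parallelogram law, with the midpoint of a and b in C. *)
    define m where "m = (1/2) *\<^sub>R a + (1/2) *\<^sub>R b"
    have "m \<in> C" unfolding m_def using C(3) that by (intro convexD) auto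
    then have "d\<^sup>2 \<le> (dist x m)\<^sup>2" using d_le d0 by (intro power_mono) auto
    moreover have "4 * (dist x m)\<^sup>2 = 2 * (dist x a)\<^sup>2 + 2 * (dist x b)\<^sup>2 - (dist a b)\<^sup>2"
      unfolding dist_norm m_def power2_norm_eq_inner
      by (simp add: inner_simps inner_commute algebra_simps)
    ultimately show ?thesis by simp
  qed
  have dc: "(\<lambda>n. dist x (c n)) \<longlonglongrightarrow> d"
  proof (rule tendsto_sandwich[of "\<lambda>_. d" _ _ "\<lambda>n. d + inverse (real (Suc n))"])
    show "(\<lambda>n. d + inverse (real (Suc n))) \<longlonglongrightarrow> d"
      using tendsto_add[OF tendsto_const LIMSEQ_inverse_real_of_nat, of d] by simp
  qed (use c d_le in \<open>auto intro!: always_eventually less_imp_le simp del: of_nat_Suc\<close>)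
  have "Cauchy c"
  proof (rule metric_CauchyI)
    fix e :: real assume "0 < e"
    have "(\<lambda>n. (dist x (c n))\<^sup>2) \<longlonglongrightarrow> d\<^sup>2"
      by (intro tendsto_intros dc)
    from order_tendstoD(2)[OF this, of "d\<^sup>2 + e\<^sup>2 / 4"] \<open>0 < e\<close>
    obtain N where N: "\<And>n. n \<ge> N \<Longrightarrow> (dist x (c n))\<^sup>2 < d\<^sup>2 + e\<^sup>2 / 4"
      by (auto simp: eventually_sequentially)
    have "dist (c m) (c n) < e" if "m \<ge> N" "n \<ge> N" for m n
    proof -
      have "(dist (c m) (c n))\<^sup>2 < e\<^sup>2"
        using par[OF c(1) c(1), of m n] N[OF that(1)] N[OF that(2)] by simp
      then show ?thesis using \<open>0 < e\<close> by (simp add: power2_less_imp_less)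
    qed
    then show "\<exists>N. \<forall>m\<ge>N. \<forall>n\<ge>N. dist (c m) (c n) < e" by blast
  qed
  then obtain p where p: "c \<longlonglongrightarrow> p"
    by (auto simp: Cauchy_convergent_iff convergent_def)
  have pC: "p \<in> C"
    using closed_sequentially[OF C(2) _ p] c(1) by blast
  have "(\<lambda>n. dist x (c n)) \<longlonglongrightarrow> dist x p"
    by (intro tendsto_intros p)
  then have "dist x p = d" using dc LIMSEQ_unique by blast
  then have pm: "\<forall>y\<in>C. dist x p \<le> dist x y" using d_le by simp
  have "projection_onto C x = p"
    unfolding projection_onto_def
    using pC pm any_closest_point_unique[OF C(3,2)] by (intro the_equality) blast+
  then show "projection_onto C x \<in> C"
    "c \<in> C \<Longrightarrow> inner (x - projection_onto C x) (c - projection_onto C x) \<le> 0" for c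
    using pC any_closest_point_dot[OF C(3,2) pC _ pm] by auto
qed

text \<open>The hypothesis on \<open>p\<close> says that \<open>p\<close> is the projection of \<open>v\<close>. It is kept in this variational form
since this is how solutions of the variational inequality provide it.\<close>
lemma norm_projection_onto_diff_le:
  fixes C :: "'a::{real_inner, complete_space} set"
  assumes C: "C \<noteq> {}" "closed C" "convex C"
    and p: "p \<in> C" "\<And>c. c \<in> C \<Longrightarrow> inner (v - p) (c - p) \<le> 0"
  shows "norm (projection_onto C x - p) \<le> norm (x - v)"
proof -
  let ?q = "projection_onto C x"
  have "inner (x - ?q) (p - ?q) \<le> 0" "inner (v - p) (?q - p) \<le> 0"
    using projection_onto_characterization[OF C] p by auto
  then have "(norm (?q - p))\<^sup>2 \<le> inner (x - v) (?q - p)"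
    unfolding power2_norm_eq_inner by (simp add: inner_simps inner_commute)
  also have "\<dots> \<le> norm (x - v) * norm (?q - p)" by (rule norm_cauchy_schwarz)
  finally show ?thesis
    by (cases "norm (?q - p) = 0") (auto simp: power2_eq_square)
qed

lemma continuous_on_projection_onto:
  fixes C :: "'a::{real_inner, complete_space} set"
  assumes C: "C \<noteq> {}" "closed C" "convex C"
  shows "continuous_on A (projection_onto C)"
proof (rule continuous_on_subset[OF _ subset_UNIV])
  have "dist (projection_onto C x) (projection_onto C v) \<le> dist x v" for x v
    unfolding dist_norm using projection_onto_characterization[OF C]
    by (intro norm_projection_onto_diff_le C)
  then show "continuous_on UNIV (projection_onto C)"
    unfolding continuous_on_iff using le_less_trans by blast
qed

lemma cocoercive_lipschitz:
  assumes "cocoercive \<beta> B" and "\<beta> > 0"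
  shows "norm (B x - B y) \<le> norm (x - y) / \<beta>"
proof (cases "norm (B x - B y) = 0")
  case False
  have "\<beta> * (norm (B x - B y))\<^sup>2 \<le> norm (x - y) * norm (B x - B y)"
    using assms(1) norm_cauchy_schwarz[of "x - y" "B x - B y"]
    unfolding cocoercive_def by (meson order_trans)
  with False have "\<beta> * norm (B x - B y) \<le> norm (x - y)"
    by (simp add: power2_eq_square)
  then show ?thesis using assms(2) by (simp add: field_simps)
qed (use assms(2) in simp)

lemma norm_convex_combination_le:
  fixes a b u :: "'a::real_inner"
  assumes "0 \<le> l" "l \<le> 1"
  shows "(norm ((1 - l) *\<^sub>R a + l *\<^sub>R b - u))\<^sup>2 \<le> (1 - l) * (norm (a - u))\<^sup>2 + l * (norm (b - u))\<^sup>2"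
proof -
  have "(1 - l) * (norm (a - u))\<^sup>2 + l * (norm (b - u))\<^sup>2 - (norm ((1 - l) *\<^sub>R a + l *\<^sub>R b - u))\<^sup>2
      = l * (1 - l) * (norm (a - b))\<^sup>2"
    unfolding power2_norm_eq_inner
    by (simp add: inner_simps inner_commute algebra_simps)
  also have "\<dots> \<ge> 0" using assms by simp
  finally show ?thesis by simp
qed

section \<open>The iterates of the stochastic projection method\<close>

text \<open>The standing assumptions on the operator, the set and the random recursion. The auxiliary sequences
\<open>z\<close> and \<open>y\<close> are substituted into the recursion for \<open>w\<close>.\<close>
locale stochastic_projection_method = prob_space M
  for M :: "'b measure" +
  fixes B :: "'a::{real_inner, complete_space} \<Rightarrow> 'a"
    and C :: "'a set"
    and \<beta> \<sigma> \<epsilon> :: real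
    and \<gamma> lam \<alpha> :: "nat \<Rightarrow> real"
    and \<BB> w :: "nat \<Rightarrow> 'b \<Rightarrow> 'a"
  assumes beta_pos: "\<beta> > 0" and cocoercive: "cocoercive \<beta> B"
    and C: "C \<noteq> {}" "closed C" "convex C" and bounded_C: "bounded C"
    and gamma_pos: "t \<ge> 1 \<Longrightarrow> \<gamma> t > 0"
    and lam: "t \<ge> 1 \<Longrightarrow> 0 \<le> lam t" "t \<ge> 1 \<Longrightarrow> lam t \<le> 1"
    and alpha_pos: "t \<ge> 1 \<Longrightarrow> \<alpha> t > 0" and eps_pos: "\<epsilon> > 0"
    and square_integrable_BB: "t \<ge> 1 \<Longrightarrow> square_integrable M (\<BB> t)"
    and square_integrable_w1: "square_integrable M (w 1)"
    and w_Suc: "t \<ge> 1 \<Longrightarrow> \<omega> \<in> space M \<Longrightarrow> w (Suc t) \<omega> =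
      (1 - lam t) *\<^sub>R w t \<omega> + lam t *\<^sub>R projection_onto C (w t \<omega> - \<gamma> t *\<^sub>R \<BB> t \<omega>)"
    and unbiased: "t \<ge> 1 \<Longrightarrow>
      is_cond_expectation M (generated_algebra M w t) (\<BB> t) (\<lambda>\<omega>. B (w t \<omega>))"
    and cond_variance: "t \<ge> 1 \<Longrightarrow> AE \<omega> in M.
      real_cond_exp M (generated_algebra M w t) (\<lambda>\<omega>'. (norm (\<BB> t \<omega>' - B (w t \<omega>')))\<^sup>2) \<omega>
        \<le> \<sigma>\<^sup>2 * (1 + \<alpha> t * (norm (B (w t \<omega>)))\<^sup>2)"
    and step_size: "t \<ge> 1 \<Longrightarrow> \<gamma> t \<le> (2 - \<epsilon>) * \<beta> / (1 + 2 * \<sigma>\<^sup>2 * \<alpha> t)"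
begin

lemma C_bound: obtains K where "K > 0" "\<And>c. c \<in> C \<Longrightarrow> norm c \<le> K"
proof -
  obtain K where "K > 0" "\<forall>c\<in>C. norm c \<le> K"
    using bounded_C unfolding bounded_pos by blast
  then show thesis by (intro that) auto
qed

lemma B_lipschitz: "norm (B x - B y) \<le> norm (x - y) / \<beta>"
  by (rule cocoercive_lipschitz[OF cocoercive beta_pos])

lemma continuous_on_B: "continuous_on A B"
proof (rule continuous_on_subset[OF _ subset_UNIV])
  show "continuous_on UNIV B"
    unfolding continuous_on_iff
  proof (intro ballI allI impI)
    fix x :: 'a and e :: real assume "e > 0"
    then show "\<exists>d>0. \<forall>x'\<in>UNIV. dist x' x < d \<longrightarrow> dist (B x') (B x) < e"
      using beta_pos le_less_trans[OF B_lipschitz]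
      by (intro exI[of _ "e * \<beta>"]) (auto simp: dist_norm field_simps)
  qed
qed

lemma norm_B_le: "norm (B x) \<le> norm (B 0) + (1 / \<beta>) * norm x"
  using norm_triangle_ineq[of "B 0" "B x - B 0"] B_lipschitz[of x 0] by simp

lemma B_bound_on_C: obtains L where "L > 0" "\<And>c. c \<in> C \<Longrightarrow> norm (B c) \<le> L"
proof -
  obtain K where K: "K > 0" "\<And>c. c \<in> C \<Longrightarrow> norm c \<le> K" using C_bound by blast
  have "norm (B c) \<le> norm (B 0) + (1 / \<beta>) * K" if "c \<in> C" for c
    using norm_B_le[of c] mult_left_mono[OF K(2)[OF that], of "1 / \<beta>"] beta_pos by simp
  moreover have "norm (B 0) + (1 / \<beta>) * K > 0"
    using K(1) beta_pos by (simp add: add_nonneg_pos)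
  ultimately show thesis by (rule that[rotated])
qed

lemma gamma_bound: "t \<ge> 1 \<Longrightarrow> \<gamma> t * (1 + 2 * \<sigma>\<^sup>2 * \<alpha> t) \<le> (2 - \<epsilon>) * \<beta>"
  using step_size[of t] alpha_pos[of t] by (simp add: pos_le_divide_eq add_pos_nonneg)

lemma gamma_le: "t \<ge> 1 \<Longrightarrow> \<gamma> t * (1 + \<sigma>\<^sup>2 * \<alpha> t) \<le> 2 * \<beta>"
proof -
  assume t: "t \<ge> 1"
  have "\<gamma> t * (1 + \<sigma>\<^sup>2 * \<alpha> t) \<le> \<gamma> t * (1 + 2 * \<sigma>\<^sup>2 * \<alpha> t)"
    using gamma_pos[OF t] alpha_pos[OF t] by (intro mult_left_mono) auto
  also have "\<dots> \<le> 2 * \<beta>"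
    using gamma_bound[OF t] mult_pos_pos[OF eps_pos beta_pos] by (simp add: algebra_simps)
  finally show ?thesis .
qed

text \<open>Apart from the first one, the iterates are convex combinations of the previous iterate and a point of
the bounded set \<open>C\<close>.\<close>
lemma square_integrable_w: "t \<ge> 1 \<Longrightarrow> square_integrable M (w t)"
proof (induction t rule: nat_induct_at_least)
  case base
  show ?case by (rule square_integrable_w1)
next
  case (Suc t)
  obtain K where K: "\<And>c. c \<in> C \<Longrightarrow> norm c \<le> K" using C_bound by blast
  have "strongly_measurable M (\<lambda>\<omega>. projection_onto C (w t \<omega> - \<gamma> t *\<^sub>R \<BB> t \<omega>))"
    using Suc square_integrable_BB[of t] unfolding square_integrable_def
    by (intro strongly_measurable_compose[OF _ continuous_on_projection_onto[OF C]]
        strongly_measurable_diff strongly_measurable_scaleR) auto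
  then have "square_integrable M (\<lambda>\<omega>. projection_onto C (w t \<omega> - \<gamma> t *\<^sub>R \<BB> t \<omega>))"
    using K projection_onto_characterization(1)[OF C]
    by (intro square_integrable_bounded[OF finite_measure_axioms]) auto
  then have "square_integrable M (\<lambda>\<omega>. (1 - lam t) *\<^sub>R w t \<omega>
      + lam t *\<^sub>R projection_onto C (w t \<omega> - \<gamma> t *\<^sub>R \<BB> t \<omega>))"
    by (intro square_integrable_add square_integrable_scaleR Suc.IH)
  then show ?case
    using square_integrable_cong[of M "w (Suc t)", OF w_Suc[OF Suc.hyps]] by simp
qed

lemma square_integrable_B: "t \<ge> 1 \<Longrightarrow> square_integrable M (\<lambda>\<omega>. B (w t \<omega>))"
proof -
  assume t: "t \<ge> 1"
  have "strongly_measurable M (\<lambda>\<omega>. B (w t \<omega>))"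
    using square_integrable_w[OF t] unfolding square_integrable_def
    by (intro strongly_measurable_compose[OF _ continuous_on_B]) auto
  then show ?thesis
    by (rule square_integrable_dominated[OF _ square_integrable_w[OF t] finite_measure_axioms norm_B_le])
qed

section \<open>The expected change of the squared distance in one step\<close>

lemma w_measurable_generated:
  assumes "t \<ge> 1"
  shows "w t \<in> borel_measurable (generated_algebra M w t)"
proof (rule measurableI)
  fix A :: "'a set" assume A: "A \<in> sets borel"
  let ?G = "{w i -` A \<inter> space M | i A. i \<in> {1..t} \<and> A \<in> sets borel}"
  have "?G \<subseteq> Pow (space M)" by auto
  then have "space (generated_algebra M w t) = space M"
    "sets (generated_algebra M w t) = sigma_sets (space M) ?G"
    unfolding generated_algebra_def by (rule space_measure_of, rule sets_measure_of)
  moreover have "w t -` A \<inter> space M \<in> ?G"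
    using A assms by force
  ultimately show "w t -` A \<inter> space (generated_algebra M w t) \<in> sets (generated_algebra M w t)"
    by auto
qed simp

lemma noise_orthogonal:
  assumes t: "t \<ge> 1" and W: "W \<in> borel_measurable (generated_algebra M w t)" "square_integrable M W"
  shows "(\<integral>\<omega>. inner (\<BB> t \<omega> - B (w t \<omega>)) (W \<omega>) \<partial>M) = 0"
proof (rule cond_expectation_error_orthogonal[OF unbiased[OF t] W(1)])
  show "strongly_measurable M W" using W(2) by (simp add: square_integrable_def)
  show "integrable M (\<lambda>\<omega>. norm (\<BB> t \<omega> - B (w t \<omega>)) * norm (W \<omega>))"
    by (intro integrable_norm_mult_norm square_integrable_diff square_integrable_BB
        square_integrable_B t W)
qed

lemma noise_variance:
  assumes t: "t \<ge> 1"
  shows "(\<integral>\<omega>. (norm (\<BB> t \<omega> - B (w t \<omega>)))\<^sup>2 \<partial>M)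
    \<le> \<sigma>\<^sup>2 * (1 + \<alpha> t * (\<integral>\<omega>. (norm (B (w t \<omega>)))\<^sup>2 \<partial>M))"
proof -
  let ?F = "generated_algebra M w t" and ?g = "\<lambda>\<omega>. (norm (\<BB> t \<omega> - B (w t \<omega>)))\<^sup>2"
  interpret F: finite_measure_subalgebra M ?F
    using unbiased[OF t] by unfold_locales (simp add: is_cond_expectation_def)
  have g: "integrable M ?g"
    using square_integrable_diff[OF square_integrable_BB[OF t] square_integrable_B[OF t]]
    by (simp add: square_integrable_def)
  have B: "integrable M (\<lambda>\<omega>. (norm (B (w t \<omega>)))\<^sup>2)"
    using square_integrable_B[OF t] by (simp add: square_integrable_def)
  have "(\<integral>\<omega>. ?g \<omega> \<partial>M) = (\<integral>\<omega>. real_cond_exp M ?F ?g \<omega> \<partial>M)"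
    by (rule F.real_cond_exp_int(2)[OF g, symmetric])
  also have "\<dots> \<le> (\<integral>\<omega>. \<sigma>\<^sup>2 * (1 + \<alpha> t * (norm (B (w t \<omega>)))\<^sup>2) \<partial>M)"
    using B by (intro integral_mono_AE F.real_cond_exp_int(1)[OF g] cond_variance[OF t]) auto
  also have "\<dots> = \<sigma>\<^sup>2 * (1 + \<alpha> t * (\<integral>\<omega>. (norm (B (w t \<omega>)))\<^sup>2 \<partial>M))"
    using B by (simp add: prob_space)
  finally show ?thesis .
qed

text \<open>The hypothesis on \<open>b\<close> makes \<open>u\<close> the projection of \<open>u - \<gamma> t *\<^sub>R b\<close>, for every step size. The choice
\<open>b = 0\<close> is possible for every \<open>u \<in> C\<close> and leads to the gap estimate; the choice \<open>b = B u\<close> is possible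
when \<open>u\<close> is a solution and leads to the summability of the squared operator errors.\<close>
lemma expected_step:
  assumes t: "t \<ge> 1" and u: "u \<in> C" and b: "\<And>c. c \<in> C \<Longrightarrow> inner b (c - u) \<ge> 0"
  shows "(\<integral>\<omega>. (norm (w (Suc t) \<omega> - u))\<^sup>2 \<partial>M) \<le> (\<integral>\<omega>. (norm (w t \<omega> - u))\<^sup>2 \<partial>M)
    - 2 * lam t * \<gamma> t * (\<integral>\<omega>. inner (w t \<omega> - u) (B (w t \<omega>) - b) \<partial>M)
    + lam t * (\<gamma> t)\<^sup>2 * ((\<integral>\<omega>. (norm (B (w t \<omega>) - b))\<^sup>2 \<partial>M)
        + \<sigma>\<^sup>2 * (1 + \<alpha> t * (\<integral>\<omega>. (norm (B (w t \<omega>)))\<^sup>2 \<partial>M)))"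
proof -
  define W where "W \<omega> = w t \<omega> - u" for \<omega>
  define D where "D \<omega> = B (w t \<omega>) - b" for \<omega>
  define Z where "Z \<omega> = \<BB> t \<omega> - B (w t \<omega>)" for \<omega>
  note sq = square_integrable_w[OF t] square_integrable_B[OF t] square_integrable_BB[OF t]
    square_integrable_const[OF finite_measure_axioms]
  have W: "square_integrable M W" and D: "square_integrable M D" and Z: "square_integrable M Z"
    unfolding W_def D_def Z_def by (intro square_integrable_diff sq)+
  note int = integrable_inner_if_square_integrable[OF W D] integrable_inner_if_square_integrable[OF Z W]
    integrable_inner_if_square_integrable[OF Z D]
    W[unfolded square_integrable_def, THEN conjunct2]
    D[unfolded square_integrable_def, THEN conjunct2]
    Z[unfolded square_integrable_def, THEN conjunct2]
  have ZW: "(\<integral>\<omega>. inner (Z \<omega>) (W \<omega>) \<partial>M) = 0"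
    unfolding Z_def
  proof (rule noise_orthogonal[OF t _ W])
    show "W \<in> borel_measurable (generated_algebra M w t)"
      unfolding W_def
      by (rule measurable_compose[OF w_measurable_generated[OF t]])
        (auto intro!: borel_measurable_continuous_onI continuous_intros)
  qed
  have ZD: "(\<integral>\<omega>. inner (Z \<omega>) (D \<omega>) \<partial>M) = 0"
    unfolding Z_def
  proof (rule noise_orthogonal[OF t _ D])
    show "D \<in> borel_measurable (generated_algebra M w t)"
      unfolding D_def
      by (rule measurable_compose[OF w_measurable_generated[OF t]])
        (auto intro!: borel_measurable_continuous_onI continuous_intros continuous_on_B)
  qed
  have pointwise: "(norm (w (Suc t) \<omega> - u))\<^sup>2 \<le> (norm (W \<omega>))\<^sup>2
      - 2 * lam t * \<gamma> t * (inner (W \<omega>) (D \<omega>) + inner (Z \<omega>) (W \<omega>))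
      + lam t * (\<gamma> t)\<^sup>2 * ((norm (D \<omega>))\<^sup>2 + 2 * inner (Z \<omega>) (D \<omega>) + (norm (Z \<omega>))\<^sup>2)"
    if \<omega>: "\<omega> \<in> space M" for \<omega>
  proof -
    let ?z = "w t \<omega> - \<gamma> t *\<^sub>R \<BB> t \<omega>" and ?v = "u - \<gamma> t *\<^sub>R b"
    have "inner (?v - u) (c - u) \<le> 0" if "c \<in> C" for c
      using b[OF that] gamma_pos[OF t] by (simp add: mult_nonneg_nonneg)
    then have "norm (projection_onto C ?z - u) \<le> norm (?z - ?v)"
      by (intro norm_projection_onto_diff_le[OF C u])
    then have "(norm (projection_onto C ?z - u))\<^sup>2 \<le> (norm (?z - ?v))\<^sup>2"
      by (intro power_mono) auto
    then have "(norm (w (Suc t) \<omega> - u))\<^sup>2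
        \<le> (1 - lam t) * (norm (w t \<omega> - u))\<^sup>2 + lam t * (norm (?z - ?v))\<^sup>2"
      unfolding w_Suc[OF t \<omega>]
      by (intro order_trans[OF norm_convex_combination_le[OF lam[OF t]]] add_left_mono
          mult_left_mono lam(1)[OF t])
    (* The noise Z is split off from the operator difference D, as only the cross terms with Z vanish. *)
    also have "?z - ?v = W \<omega> - \<gamma> t *\<^sub>R (D \<omega> + Z \<omega>)"
      by (simp add: W_def D_def Z_def algebra_simps)
    also have "(1 - lam t) * (norm (w t \<omega> - u))\<^sup>2 + lam t * (norm (W \<omega> - \<gamma> t *\<^sub>R (D \<omega> + Z \<omega>)))\<^sup>2
      = (norm (W \<omega>))\<^sup>2 - 2 * lam t * \<gamma> t * (inner (W \<omega>) (D \<omega>) + inner (Z \<omega>) (W \<omega>))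
        + lam t * (\<gamma> t)\<^sup>2 * ((norm (D \<omega>))\<^sup>2 + 2 * inner (Z \<omega>) (D \<omega>) + (norm (Z \<omega>))\<^sup>2)"
      unfolding W_def[symmetric] power2_norm_eq_inner
      by (simp add: inner_simps inner_commute algebra_simps power2_eq_square)
    finally show ?thesis .
  qed
  have "square_integrable M (\<lambda>\<omega>. w (Suc t) \<omega> - u)"
    by (intro square_integrable_diff square_integrable_w sq) simp
  then have "(\<integral>\<omega>. (norm (w (Suc t) \<omega> - u))\<^sup>2 \<partial>M) \<le> (\<integral>\<omega>. (norm (W \<omega>))\<^sup>2
      - 2 * lam t * \<gamma> t * (inner (W \<omega>) (D \<omega>) + inner (Z \<omega>) (W \<omega>))
      + lam t * (\<gamma> t)\<^sup>2 * ((norm (D \<omega>))\<^sup>2 + 2 * inner (Z \<omega>) (D \<omega>) + (norm (Z \<omega>))\<^sup>2) \<partial>M)"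
    using int by (intro integral_mono pointwise) (auto simp: square_integrable_def)
  also have "\<dots> = (\<integral>\<omega>. (norm (W \<omega>))\<^sup>2 \<partial>M) - 2 * lam t * \<gamma> t * (\<integral>\<omega>. inner (W \<omega>) (D \<omega>) \<partial>M)
      + lam t * (\<gamma> t)\<^sup>2 * ((\<integral>\<omega>. (norm (D \<omega>))\<^sup>2 \<partial>M) + (\<integral>\<omega>. (norm (Z \<omega>))\<^sup>2 \<partial>M))"
    using int ZW ZD by simp
  also have "\<dots> \<le> (\<integral>\<omega>. (norm (W \<omega>))\<^sup>2 \<partial>M) - 2 * lam t * \<gamma> t * (\<integral>\<omega>. inner (W \<omega>) (D \<omega>) \<partial>M)
      + lam t * (\<gamma> t)\<^sup>2 * ((\<integral>\<omega>. (norm (D \<omega>))\<^sup>2 \<partial>M)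
        + \<sigma>\<^sup>2 * (1 + \<alpha> t * (\<integral>\<omega>. (norm (B (w t \<omega>)))\<^sup>2 \<partial>M)))"
    using noise_variance[OF t] lam(1)[OF t] unfolding Z_def
    by (intro add_left_mono mult_left_mono) auto
  finally show ?thesis unfolding W_def D_def .
qed

section \<open>The upper bound for the gap at the mean of the averages\<close>

lemma integrable_inner_w: "t \<ge> 1 \<Longrightarrow> integrable M (\<lambda>\<omega>. inner (w t \<omega> - p) e)"
  by (intro integrable_inner_if_square_integrable square_integrable_diff square_integrable_w
      square_integrable_const finite_measure_axioms)

lemma integrable_norm_w: "t \<ge> 1 \<Longrightarrow> integrable M (\<lambda>\<omega>. (norm (w t \<omega> - p))\<^sup>2)"
  using square_integrable_diff[OF square_integrable_w square_integrable_const[OF finite_measure_axioms], of t p]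
  by (simp add: square_integrable_def)

definition mean_average :: "nat \<Rightarrow> 'a" where
  "mean_average n = bochner_expectation M
    (\<lambda>\<omega>. (\<Sum>t=1..n. (\<gamma> t * lam t) *\<^sub>R w t \<omega>) /\<^sub>R (\<Sum>t=1..n. \<gamma> t * lam t))"

text \<open>The average is tested against a vector \<open>e\<close>, which turns its Bochner expectation into a
weighted sum of real integrals over the single iterates.\<close>
lemma inner_mean_average:
  assumes S: "(\<Sum>t=1..n. \<gamma> t * lam t) > 0"
  shows "(\<Sum>t=1..n. \<gamma> t * lam t) * inner (mean_average n - p) e
    = (\<Sum>t=1..n. \<gamma> t * lam t * (\<integral>\<omega>. inner (w t \<omega> - p) e \<partial>M))"
proof -
  let ?S = "\<Sum>t=1..n. \<gamma> t * lam t"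
  let ?W = "\<lambda>\<omega>. (\<Sum>t=1..n. (\<gamma> t * lam t) *\<^sub>R w t \<omega>) /\<^sub>R ?S"
  have sum: "square_integrable M (\<lambda>\<omega>. \<Sum>t\<in>I. (\<gamma> t * lam t) *\<^sub>R w t \<omega>)" if "I \<subseteq> {1..}" for I
    using that
  proof (induction I rule: infinite_finite_induct)
    case (insert t I)
    then show ?case
      by (auto intro!: square_integrable_add square_integrable_scaleR square_integrable_w)
  qed (auto intro: square_integrable_const finite_measure_axioms)
  have "square_integrable M ?W"
    by (intro square_integrable_scaleR sum) auto
  then have W: "bochner_integrable M ?W"
    by (intro bochner_integrable_if_integrable_norm integrable_norm_if_square_integrable finite_measure_axioms)
      (simp_all add: square_integrable_def)
  have "?S * inner (mean_average n - p) e = ?S * inner (mean_average n) e - ?S * inner p e"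
    by (simp add: inner_diff_left algebra_simps)
  also have "?S * inner (mean_average n) e = ?S * (\<integral>\<omega>. inner (?W \<omega>) e \<partial>M)"
    unfolding mean_average_def inner_bochner_expectation[OF W] ..
  also have "\<dots> - ?S * inner p e = (\<integral>\<omega>. ?S * inner (?W \<omega>) e - ?S * inner p e \<partial>M)"
    using integrable_inner[OF W, of e] by (simp add: prob_space)
  also have "\<dots> = (\<integral>\<omega>. (\<Sum>t=1..n. \<gamma> t * lam t * inner (w t \<omega> - p) e) \<partial>M)"
  proof (rule Bochner_Integration.integral_cong[OF refl])
    fix \<omega>
    have "?S * inner (?W \<omega>) e = inner (\<Sum>t=1..n. (\<gamma> t * lam t) *\<^sub>R w t \<omega>) e"
      using S by simp
    then show "?S * inner (?W \<omega>) e - ?S * inner p e = (\<Sum>t=1..n. \<gamma> t * lam t * inner (w t \<omega> - p) e)"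
      by (simp add: inner_sum_left sum_distrib_right inner_diff_left right_diff_distrib sum_subtractf)
  qed
  also have "\<dots> = (\<Sum>t=1..n. \<integral>\<omega>. \<gamma> t * lam t * inner (w t \<omega> - p) e \<partial>M)"
    by (rule Bochner_Integration.integral_sum) (auto intro!: integrable_mult_right integrable_inner_w)
  finally show ?thesis by simp
qed

text \<open>The terms with \<open>(\<gamma> t)\<^sup>2\<close> in \<open>expected_step\<close> for \<open>b = 0\<close>, which do not telescope.\<close>
definition noise_budget :: "nat \<Rightarrow> real" where
  "noise_budget n = 1/2 * (\<Sum>t=1..n. lam t * (\<gamma> t)\<^sup>2 * (1 + \<sigma>\<^sup>2 * \<alpha> t) * (\<integral>\<omega>. (norm (B (w t \<omega>)))\<^sup>2 \<partial>M)
        + \<sigma>\<^sup>2 * lam t * (\<gamma> t)\<^sup>2)"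

definition initial_budget :: real where
  "initial_budget = (SUP u\<in>C. 1/2 * (\<integral>\<omega>. (norm (w 1 \<omega> - u))\<^sup>2 \<partial>M))"

lemma inner_B_monotone: "inner (x - u) (B u) \<le> inner (x - u) (B x)"
proof -
  have "0 \<le> \<beta> * (norm (B x - B u))\<^sup>2" using beta_pos by simp
  also have "\<dots> \<le> inner (x - u) (B x - B u)"
    using cocoercive unfolding cocoercive_def by blast
  finally show ?thesis by (simp add: inner_diff_right)
qed

text \<open>Monotonicity of \<open>B\<close> replaces \<open>B (w t \<omega>)\<close> by \<open>B u\<close> in the one-step estimate, which makes the left hand
side linear in the iterates and hence a statement on the average. The expected squared distances
telescope.\<close>
lemma telescoped_gap:
  assumes u: "u \<in> C"
  shows "(\<Sum>t=1..n. \<gamma> t * lam t * (\<integral>\<omega>. inner (w t \<omega> - u) (B u) \<partial>M))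
    + 1/2 * (\<integral>\<omega>. (norm (w (Suc n) \<omega> - u))\<^sup>2 \<partial>M)
    \<le> 1/2 * (\<integral>\<omega>. (norm (w 1 \<omega> - u))\<^sup>2 \<partial>M) + noise_budget n"
proof (induction n)
  case 0
  then show ?case by (simp add: noise_budget_def)
next
  case (Suc n)
  have t: "Suc n \<ge> 1" by simp
  let ?b = "\<integral>\<omega>. (norm (B (w (Suc n) \<omega>)))\<^sup>2 \<partial>M"
  let ?i = "\<integral>\<omega>. inner (w (Suc n) \<omega> - u) (B u) \<partial>M"
  let ?j = "\<integral>\<omega>. inner (w (Suc n) \<omega> - u) (B (w (Suc n) \<omega>)) \<partial>M"
  have "?i \<le> ?j"
    by (intro integral_mono integrable_inner_w t inner_B_monotone integrable_inner_if_square_integrable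
        square_integrable_B square_integrable_diff square_integrable_w square_integrable_const finite_measure_axioms)
  then have "\<gamma> (Suc n) * lam (Suc n) * ?i \<le> \<gamma> (Suc n) * lam (Suc n) * ?j"
    using gamma_pos[OF t] lam(1)[OF t] by (intro mult_left_mono) auto
  moreover have "(\<integral>\<omega>. (norm (w (Suc (Suc n)) \<omega> - u))\<^sup>2 \<partial>M) \<le> (\<integral>\<omega>. (norm (w (Suc n) \<omega> - u))\<^sup>2 \<partial>M)
      - 2 * lam (Suc n) * \<gamma> (Suc n) * ?j
      + lam (Suc n) * (\<gamma> (Suc n))\<^sup>2 * (?b + \<sigma>\<^sup>2 * (1 + \<alpha> (Suc n) * ?b))"
    using expected_step[OF t u, of 0] by simp
  moreover have "noise_budget (Suc n) = noise_budget n
      + 1/2 * (lam (Suc n) * (\<gamma> (Suc n))\<^sup>2 * (?b + \<sigma>\<^sup>2 * (1 + \<alpha> (Suc n) * ?b)))"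
    by (simp add: noise_budget_def algebra_simps)
  ultimately show ?case
    using Suc.IH by (simp add: algebra_simps)
qed

lemma initial_budget_ge:
  assumes u: "u \<in> C"
  shows "1/2 * (\<integral>\<omega>. (norm (w 1 \<omega> - u))\<^sup>2 \<partial>M) \<le> initial_budget"
  unfolding initial_budget_def
proof (rule cSUP_upper[OF u])
  obtain K where K: "K > 0" "\<And>c. c \<in> C \<Longrightarrow> norm c \<le> K" using C_bound by blast
  have int: "integrable M (\<lambda>\<omega>. 2 * (norm (w 1 \<omega>))\<^sup>2 + 2 * K\<^sup>2)"
    using square_integrable_w1 by (simp add: square_integrable_def)
  have "(\<integral>\<omega>. (norm (w 1 \<omega> - u))\<^sup>2 \<partial>M) \<le> (\<integral>\<omega>. 2 * (norm (w 1 \<omega>))\<^sup>2 + 2 * K\<^sup>2 \<partial>M)"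
    if u: "u \<in> C" for u
  proof (rule integral_mono[OF integrable_norm_w int])
    fix \<omega>
    have "norm (w 1 \<omega> - u) \<le> norm (w 1 \<omega>) + K"
      using norm_triangle_ineq4[of "w 1 \<omega>" u] K(2)[OF u] by simp
    then have "(norm (w 1 \<omega> - u))\<^sup>2 \<le> (norm (w 1 \<omega>) + K)\<^sup>2"
      by (intro power_mono) auto
    also have "\<dots> \<le> 2 * (norm (w 1 \<omega>))\<^sup>2 + 2 * K\<^sup>2"
      using sum_squares_bound[of "norm (w 1 \<omega>)" K] by (simp add: power2_sum)
    finally show "(norm (w 1 \<omega> - u))\<^sup>2 \<le> 2 * (norm (w 1 \<omega>))\<^sup>2 + 2 * K\<^sup>2" .
  qed simp
  then show "bdd_above ((\<lambda>u. 1/2 * (\<integral>\<omega>. (norm (w 1 \<omega> - u))\<^sup>2 \<partial>M)) ` C)"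
    by (intro bdd_aboveI2[of _ _ "1/2 * (\<integral>\<omega>. 2 * (norm (w 1 \<omega>))\<^sup>2 + 2 * K\<^sup>2 \<partial>M)"]) auto
qed

lemma gap_upper_bound:
  assumes S: "(\<Sum>t=1..n. \<gamma> t * lam t) > 0"
  shows "vi_gap B C (mean_average n) \<le> (initial_budget + noise_budget n) / (\<Sum>t=1..n. \<gamma> t * lam t)"
  unfolding vi_gap_def
proof (rule cSUP_least[OF C(1)])
  fix u assume u: "u \<in> C"
  have "0 \<le> (\<integral>\<omega>. (norm (w (Suc n) \<omega> - u))\<^sup>2 \<partial>M)" by simp
  then have "(\<Sum>t=1..n. \<gamma> t * lam t) * inner (mean_average n - u) (B u) \<le> initial_budget + noise_budget n"
    unfolding inner_mean_average[OF S]
    using telescoped_gap[OF u, of n] initial_budget_ge[OF u] by linarith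
  then show "inner (B u) (mean_average n - u)
      \<le> (initial_budget + noise_budget n) / (\<Sum>t=1..n. \<gamma> t * lam t)"
    using S by (simp add: pos_le_divide_eq inner_commute mult.commute)
qed

section \<open>The lower bound for the gap\<close>

text \<open>The point of \<open>C\<close> nearest to \<open>x\<close> is a competitor in the supremum that defines the gap, and \<open>B\<close> is
bounded on \<open>C\<close>.\<close>
lemma gap_ge_neg_distance:
  obtains L where "L > 0"
    "\<And>x. vi_gap B C x \<ge> - L * norm (x - projection_onto C x)"
proof -
  obtain L where L: "L > 0" "\<And>c. c \<in> C \<Longrightarrow> norm (B c) \<le> L" using B_bound_on_C by blast
  obtain K where K: "\<And>c. c \<in> C \<Longrightarrow> norm c \<le> K" using C_bound by blast
  have "vi_gap B C x \<ge> - L * norm (x - projection_onto C x)" for x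
  proof -
    let ?p = "projection_onto C x"
    have p: "?p \<in> C" by (rule projection_onto_characterization(1)[OF C])
    have "inner (B c) (x - c) \<le> L * (norm x + K)" if "c \<in> C" for c
    proof -
      have "inner (B c) (x - c) \<le> norm (B c) * norm (x - c)" by (rule norm_cauchy_schwarz)
      also have "\<dots> \<le> L * (norm x + K)"
        using L K[OF that] norm_triangle_ineq4[of x c] by (intro mult_mono L that) auto
      finally show ?thesis .
    qed
    then have "bdd_above ((\<lambda>c. inner (B c) (x - c)) ` C)"
      by (intro bdd_aboveI2[of _ _ "L * (norm x + K)"])
    then have "inner (B ?p) (x - ?p) \<le> vi_gap B C x"
      unfolding vi_gap_def by (rule cSUP_upper[OF p])
    moreover have "\<bar>inner (B ?p) (x - ?p)\<bar> \<le> norm (B ?p) * norm (x - ?p)"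
      by (rule Cauchy_Schwarz_ineq2)
    moreover have "\<dots> \<le> L * norm (x - ?p)"
      by (intro mult_right_mono L p) simp
    ultimately show ?thesis by linarith
  qed
  with L(1) show thesis by (rule that)
qed

text \<open>With \<open>p\<^sub>t\<close> for the product, \<open>\<lambda>\<^sub>t p\<^sub>t = p\<^sub>t - p\<^sub>t\<^sub>+\<^sub>1\<close>: the sum telescopes.\<close>
lemma sum_lam_mult_residual:
  "(\<Sum>t=1..n. lam t * (\<Prod>s=1..<t. 1 - lam s)) = 1 - (\<Prod>s=1..n. 1 - lam s)"
proof (induction n)
  case (Suc n)
  then show ?case
    by (simp add: atLeastLessThanSuc_atLeastAtMost algebra_simps)
qed simp

lemma residual_nonneg: "0 \<le> (\<Prod>s=1..<t. 1 - lam s)"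
  using lam by (intro prod_nonneg) auto

text \<open>Every projected point lies in the half-space \<open>inner (c - p) e \<le> 0\<close>, so that only the fraction of the
starting point that is still present in \<open>w t \<omega>\<close> can lie outside of it.\<close>
lemma inner_w_le_residual:
  assumes t: "t \<ge> 1" and \<omega>: "\<omega> \<in> space M" and e: "\<And>c. c \<in> C \<Longrightarrow> inner (c - p) e \<le> 0"
  shows "inner (w t \<omega> - p) e \<le> (\<Prod>s=1..<t. 1 - lam s) * inner (w 1 \<omega> - p) e"
  using t
proof (induction t rule: nat_induct_at_least)
  case base
  then show ?case by simp
next
  case (Suc t)
  let ?y = "projection_onto C (w t \<omega> - \<gamma> t *\<^sub>R \<BB> t \<omega>)"
  have "inner (w (Suc t) \<omega> - p) e = (1 - lam t) * inner (w t \<omega> - p) e + lam t * inner (?y - p) e"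
    unfolding w_Suc[OF Suc.hyps \<omega>] by (simp add: inner_simps algebra_simps)
  also have "lam t * inner (?y - p) e \<le> 0"
    using lam(1)[OF Suc.hyps] e[OF projection_onto_characterization(1)[OF C]]
    by (rule mult_nonneg_nonpos)
  also have "(1 - lam t) * inner (w t \<omega> - p) e
      \<le> (1 - lam t) * ((\<Prod>s=1..<t. 1 - lam s) * inner (w 1 \<omega> - p) e)"
    using lam(2)[OF Suc.hyps] by (intro mult_left_mono Suc.IH) auto
  finally show ?case
    using Suc.hyps by (simp add: prod.atLeastLessThan_Suc mult_ac)
qed

text \<open>Let \<open>p\<close> be the projection of the mean and \<open>e\<close> the difference. The half-space
\<open>inner (c - p) e \<le> 0\<close> contains \<open>C\<close>, so that \<open>inner_w_le_residual\<close> bounds each term of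
\<open>\<Sum> \<gamma>\<^sub>t \<lambda>\<^sub>t E \<langle>w\<^sub>t - p | e\<rangle>\<close>, which is the sum of the weights times \<open>\<parallel>e\<parallel>\<^sup>2\<close>. The step sizes are at most
\<open>2 \<beta>\<close>, and what remains is the telescoping sum of \<open>sum_lam_mult_residual\<close>.\<close>
lemma mean_average_near_C:
  obtains K where "\<And>n. (\<Sum>t=1..n. \<gamma> t * lam t) > 0 \<Longrightarrow>
    (\<Sum>t=1..n. \<gamma> t * lam t) * norm (mean_average n - projection_onto C (mean_average n)) \<le> K"
proof -
  obtain K where K: "\<And>c. c \<in> C \<Longrightarrow> norm c \<le> K" using C_bound by blast
  define J where "J = (\<integral>\<omega>. norm (w 1 \<omega>) + K \<partial>M)"
  have int: "integrable M (\<lambda>\<omega>. norm (w 1 \<omega>) + K)"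
    using integrable_norm_if_square_integrable[OF square_integrable_w1 finite_measure_axioms] by simp
  have "(\<Sum>t=1..n. \<gamma> t * lam t) * norm (mean_average n - projection_onto C (mean_average n)) \<le> 2 * \<beta> * J"
    if S: "(\<Sum>t=1..n. \<gamma> t * lam t) > 0" for n
  proof -
    let ?S = "\<Sum>t=1..n. \<gamma> t * lam t" and ?p = "projection_onto C (mean_average n)"
    let ?r = "\<lambda>t. \<Prod>s=1..<t. 1 - lam s"
    define e where "e = mean_average n - ?p"
    have p: "?p \<in> C" by (rule projection_onto_characterization(1)[OF C])
    have e: "inner (c - ?p) e \<le> 0" if "c \<in> C" for c
      using projection_onto_characterization(2)[OF C that, of "mean_average n"]
      by (subst inner_commute) (simp add: e_def)
    have "K \<ge> 0" using K[OF p] norm_ge_zero order_trans by blast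
    then have J: "J \<ge> 0" unfolding J_def by simp
    have w1: "(\<integral>\<omega>. inner (w 1 \<omega> - ?p) e \<partial>M) \<le> J * norm e"
    proof -
      have "(\<integral>\<omega>. inner (w 1 \<omega> - ?p) e \<partial>M) \<le> (\<integral>\<omega>. (norm (w 1 \<omega>) + K) * norm e \<partial>M)"
      proof (rule integral_mono[OF integrable_inner_w])
        show "integrable M (\<lambda>\<omega>. (norm (w 1 \<omega>) + K) * norm e)" using int by simp
        fix \<omega>
        have "norm (w 1 \<omega> - ?p) \<le> norm (w 1 \<omega>) + K"
          using norm_triangle_ineq4[of "w 1 \<omega>" ?p] K[OF p] by simp
        then show "inner (w 1 \<omega> - ?p) e \<le> (norm (w 1 \<omega>) + K) * norm e"
          by (intro order_trans[OF norm_cauchy_schwarz] mult_right_mono) auto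
      qed simp
      then show ?thesis using int by (simp add: J_def)
    qed
    have step: "\<gamma> t * lam t * (\<integral>\<omega>. inner (w t \<omega> - ?p) e \<partial>M) \<le> lam t * ?r t * (2 * \<beta> * (J * norm e))"
      if t: "t \<ge> 1" for t
    proof -
      have "(\<integral>\<omega>. inner (w t \<omega> - ?p) e \<partial>M) \<le> (\<integral>\<omega>. ?r t * inner (w 1 \<omega> - ?p) e \<partial>M)"
        by (intro integral_mono integrable_mult_right integrable_inner_w t inner_w_le_residual e) auto
      also have "\<dots> = ?r t * (\<integral>\<omega>. inner (w 1 \<omega> - ?p) e \<partial>M)" by simp
      also have "\<dots> \<le> ?r t * (J * norm e)"
        by (intro mult_left_mono w1 residual_nonneg)
      finally have "\<gamma> t * lam t * (\<integral>\<omega>. inner (w t \<omega> - ?p) e \<partial>M) \<le> \<gamma> t * lam t * (?r t * (J * norm e))"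
        using gamma_pos[OF t] lam(1)[OF t] by (intro mult_left_mono) auto
      also have "\<dots> = \<gamma> t * (lam t * ?r t * (J * norm e))" by simp
      also have "\<dots> \<le> (2 * \<beta>) * (lam t * ?r t * (J * norm e))"
      proof (rule mult_right_mono)
        have "\<gamma> t * 1 \<le> \<gamma> t * (1 + \<sigma>\<^sup>2 * \<alpha> t)"
          using gamma_pos[OF t] alpha_pos[OF t] by (intro mult_left_mono) auto
        then show "\<gamma> t \<le> 2 * \<beta>" using gamma_le[OF t] by simp
        show "0 \<le> lam t * ?r t * (J * norm e)"
          using lam(1)[OF t] residual_nonneg[of t] J by (intro mult_nonneg_nonneg) auto
      qed
      finally show ?thesis by (simp add: mult_ac)
    qed
    have "?S * (norm e)\<^sup>2 = (\<Sum>t=1..n. \<gamma> t * lam t * (\<integral>\<omega>. inner (w t \<omega> - ?p) e \<partial>M))"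
      using inner_mean_average[OF S, of ?p e] by (simp add: e_def power2_norm_eq_inner)
    also have "\<dots> \<le> (\<Sum>t=1..n. lam t * ?r t * (2 * \<beta> * (J * norm e)))"
      by (intro sum_mono step) auto
    also have "\<dots> = (1 - (\<Prod>s=1..n. 1 - lam s)) * (2 * \<beta> * (J * norm e))"
      unfolding sum_distrib_right[symmetric] sum_lam_mult_residual ..
    also have "\<dots> \<le> 1 * (2 * \<beta> * (J * norm e))"
      using residual_nonneg[of "Suc n"] J beta_pos
      by (intro mult_right_mono) (auto simp: atLeastLessThanSuc_atLeastAtMost)
    finally have "(?S * norm e) * norm e \<le> (2 * \<beta> * J) * norm e"
      by (simp add: power2_eq_square)
    then have "?S * norm e \<le> 2 * \<beta> * J" if "norm e \<noteq> 0"
      using that by simp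
    moreover have "0 \<le> 2 * \<beta> * J" using beta_pos J by simp
    ultimately show ?thesis unfolding e_def by (cases "norm e = 0") (auto simp: e_def)
  qed
  then show thesis by (rule that)
qed

section \<open>Boundedness of the noise contributions\<close>

text \<open>Comparison with the solution \<open>v\<close> bounds the sum of \<open>lam t * \<gamma> t * d t\<close>, where \<open>d t\<close> is the expected
squared error \<open>\<parallel>B w\<^sub>t - B v\<parallel>\<^sup>2\<close>. In the noise contributions, \<open>\<parallel>B w\<^sub>t\<parallel>\<^sup>2 \<le> 2 \<parallel>B w\<^sub>t - B v\<parallel>\<^sup>2 + 2 \<parallel>B v\<parallel>\<^sup>2\<close>;
one factor \<open>\<gamma> t * (1 + \<sigma>\<^sup>2 * \<alpha> t)\<close> is at most \<open>2 * \<beta>\<close>, which turns the first part into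
the sum just bounded, and the second part is dominated by the summable sequence.\<close>
lemma noise_budget_bounded:
  assumes v: "vi_solution B C v"
    and summable: "(\<lambda>t. lam t * (\<gamma> t)\<^sup>2 * (1 + 2 * \<alpha> t * (norm (B v))\<^sup>2)) summable_on {1..}"
  obtains K where "\<And>n. noise_budget n \<le> K"
proof -
  define q where "q t = lam t * (\<gamma> t)\<^sup>2 * (1 + 2 * \<alpha> t * (norm (B v))\<^sup>2)" for t
  define d where "d t = (\<integral>\<omega>. (norm (B (w t \<omega>) - B v))\<^sup>2 \<partial>M)" for t
  define r where "r t = (\<integral>\<omega>. (norm (w t \<omega> - v))\<^sup>2 \<partial>M)" for t
  define Q where "Q = infsum q {1..}"
  have q_nonneg: "q t \<ge> 0" if "t \<ge> 1" for t
    using lam(1)[OF that] alpha_pos[OF that] by (auto simp: q_def intro!: mult_nonneg_nonneg add_nonneg_nonneg)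
  have Q: "(\<Sum>t=1..n. q t) \<le> Q" for n
    unfolding Q_def using summable q_nonneg
    by (intro finite_sum_le_infsum) (auto simp: q_def)
  have vC: "v \<in> C" and vB: "\<And>c. c \<in> C \<Longrightarrow> inner (B v) (c - v) \<ge> 0"
    using v unfolding vi_solution_def by (auto simp: inner_diff_right)
  have Dsq: "square_integrable M (\<lambda>\<omega>. B (w t \<omega>) - B v)" if "t \<ge> 1" for t
    by (intro square_integrable_diff square_integrable_B that square_integrable_const finite_measure_axioms)
  have b_le: "(\<integral>\<omega>. (norm (B (w t \<omega>)))\<^sup>2 \<partial>M) \<le> 2 * d t + 2 * (norm (B v))\<^sup>2" if t: "t \<ge> 1" for t
  proof -
    have int: "integrable M (\<lambda>\<omega>. (norm (B (w t \<omega>) - B v))\<^sup>2)"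
      using Dsq[OF t] by (simp add: square_integrable_def)
    have "(\<integral>\<omega>. (norm (B (w t \<omega>)))\<^sup>2 \<partial>M)
        \<le> (\<integral>\<omega>. 2 * (norm (B (w t \<omega>) - B v))\<^sup>2 + 2 * (norm (B v))\<^sup>2 \<partial>M)"
    proof (rule integral_mono)
      show "integrable M (\<lambda>\<omega>. (norm (B (w t \<omega>)))\<^sup>2)"
        using square_integrable_B[OF t] by (simp add: square_integrable_def)
      show "integrable M (\<lambda>\<omega>. 2 * (norm (B (w t \<omega>) - B v))\<^sup>2 + 2 * (norm (B v))\<^sup>2)"
        using int by simp
      fix \<omega>
      have "(norm (B (w t \<omega>)))\<^sup>2 \<le> (norm (B (w t \<omega>) - B v) + norm (B v))\<^sup>2"
        using norm_triangle_ineq[of "B (w t \<omega>) - B v" "B v"] by (intro power_mono) auto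
      also have "\<dots> \<le> 2 * (norm (B (w t \<omega>) - B v))\<^sup>2 + 2 * (norm (B v))\<^sup>2"
        using sum_squares_bound[of "norm (B (w t \<omega>) - B v)" "norm (B v)"] by (simp add: power2_sum)
      finally show "(norm (B (w t \<omega>)))\<^sup>2 \<le> 2 * (norm (B (w t \<omega>) - B v))\<^sup>2 + 2 * (norm (B v))\<^sup>2" .
    qed
    also have "\<dots> = 2 * d t + 2 * (norm (B v))\<^sup>2"
      using int by (simp add: d_def prob_space)
    finally show ?thesis .
  qed
  have d_nonneg: "d t \<ge> 0" for t unfolding d_def by simp
  have fejer: "r (Suc t) + \<epsilon> * \<beta> * (lam t * \<gamma> t * d t) \<le> r t + \<sigma>\<^sup>2 * q t" if t: "t \<ge> 1" for t
  proof -
    let ?i = "\<integral>\<omega>. inner (w t \<omega> - v) (B (w t \<omega>) - B v) \<partial>M"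
    let ?b = "\<integral>\<omega>. (norm (B (w t \<omega>)))\<^sup>2 \<partial>M"
    note pos = gamma_pos[OF t] lam(1)[OF t] alpha_pos[OF t] d_nonneg[of t]
    have "\<beta> * d t = (\<integral>\<omega>. \<beta> * (norm (B (w t \<omega>) - B v))\<^sup>2 \<partial>M)" by (simp add: d_def)
    also have "\<dots> \<le> ?i"
    proof (rule integral_mono)
      show "integrable M (\<lambda>\<omega>. \<beta> * (norm (B (w t \<omega>) - B v))\<^sup>2)"
        using Dsq[OF t] by (simp add: square_integrable_def)
      show "integrable M (\<lambda>\<omega>. inner (w t \<omega> - v) (B (w t \<omega>) - B v))"
        by (intro integrable_inner_if_square_integrable Dsq t square_integrable_diff
            square_integrable_w square_integrable_const finite_measure_axioms)
      show "\<beta> * (norm (B (w t \<omega>) - B v))\<^sup>2 \<le> inner (w t \<omega> - v) (B (w t \<omega>) - B v)" for \<omega>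
        using cocoercive unfolding cocoercive_def by blast
    qed
    finally have i: "2 * lam t * \<gamma> t * (\<beta> * d t) \<le> 2 * lam t * \<gamma> t * ?i"
      using pos by (intro mult_left_mono) auto
    have "lam t * (\<gamma> t)\<^sup>2 * (d t + \<sigma>\<^sup>2 * (1 + \<alpha> t * ?b))
        \<le> lam t * (\<gamma> t)\<^sup>2 * (d t + \<sigma>\<^sup>2 * (1 + \<alpha> t * (2 * d t + 2 * (norm (B v))\<^sup>2)))"
      using pos b_le[OF t] by (intro mult_left_mono add_left_mono) auto
    (* Here the factor 1 + 2 * \<sigma>\<^sup>2 * \<alpha> t of the step size condition appears: the 1 comes from
       the squared operator error, the rest from the multiplicative part of the noise. *)
    also have "\<dots> = lam t * \<gamma> t * d t * (\<gamma> t * (1 + 2 * \<sigma>\<^sup>2 * \<alpha> t)) + \<sigma>\<^sup>2 * q t"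
      by (simp add: q_def algebra_simps power2_eq_square)
    also have "\<dots> \<le> lam t * \<gamma> t * d t * ((2 - \<epsilon>) * \<beta>) + \<sigma>\<^sup>2 * q t"
      using pos gamma_bound[OF t] by (intro add_right_mono mult_left_mono) auto
    finally have "lam t * (\<gamma> t)\<^sup>2 * (d t + \<sigma>\<^sup>2 * (1 + \<alpha> t * ?b))
        \<le> lam t * \<gamma> t * d t * ((2 - \<epsilon>) * \<beta>) + \<sigma>\<^sup>2 * q t" .
    moreover have "r (Suc t) \<le> r t - 2 * lam t * \<gamma> t * ?i
        + lam t * (\<gamma> t)\<^sup>2 * (d t + \<sigma>\<^sup>2 * (1 + \<alpha> t * ?b))"
      unfolding r_def d_def by (rule expected_step[OF t vC vB])
    ultimately show ?thesis
      using i by (simp add: algebra_simps)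
  qed
  have "r (Suc n) + \<epsilon> * \<beta> * (\<Sum>t=1..n. lam t * \<gamma> t * d t) \<le> r 1 + \<sigma>\<^sup>2 * (\<Sum>t=1..n. q t)" for n
  proof (induction n)
    case (Suc n)
    then show ?case using fejer[of "Suc n"] by (simp add: algebra_simps)
  qed simp
  moreover have "0 \<le> r n" for n unfolding r_def by simp
  ultimately have "\<epsilon> * \<beta> * (\<Sum>t=1..n. lam t * \<gamma> t * d t) \<le> r 1 + \<sigma>\<^sup>2 * Q" for n
    using mult_left_mono[OF Q, of "\<sigma>\<^sup>2" n] by (smt (verit) zero_le_power2)
  then have sum_d: "(\<Sum>t=1..n. lam t * \<gamma> t * d t) \<le> (r 1 + \<sigma>\<^sup>2 * Q) / (\<epsilon> * \<beta>)" for n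
    using mult_pos_pos[OF eps_pos beta_pos] by (simp add: pos_le_divide_eq mult.commute)
  have term_le: "lam t * (\<gamma> t)\<^sup>2 * (1 + \<sigma>\<^sup>2 * \<alpha> t) * (\<integral>\<omega>. (norm (B (w t \<omega>)))\<^sup>2 \<partial>M) + \<sigma>\<^sup>2 * lam t * (\<gamma> t)\<^sup>2
      \<le> 4 * \<beta> * (lam t * \<gamma> t * d t) + (2 * (norm (B v))\<^sup>2 + 2 * \<sigma>\<^sup>2) * q t" if t: "t \<ge> 1" for t
  proof -
    note pos = gamma_pos[OF t] lam(1)[OF t] alpha_pos[OF t] d_nonneg[of t]
    have "lam t * (\<gamma> t)\<^sup>2 * (1 + \<sigma>\<^sup>2 * \<alpha> t) * (\<integral>\<omega>. (norm (B (w t \<omega>)))\<^sup>2 \<partial>M)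
        \<le> lam t * (\<gamma> t)\<^sup>2 * (1 + \<sigma>\<^sup>2 * \<alpha> t) * (2 * d t + 2 * (norm (B v))\<^sup>2)"
      using pos by (intro mult_left_mono b_le[OF t]) auto
    also have "\<dots> = 2 * (lam t * \<gamma> t * d t) * (\<gamma> t * (1 + \<sigma>\<^sup>2 * \<alpha> t))
        + lam t * (\<gamma> t)\<^sup>2 * (1 + \<sigma>\<^sup>2 * \<alpha> t) * (2 * (norm (B v))\<^sup>2)"
      by (simp add: algebra_simps power2_eq_square)
    also have "2 * (lam t * \<gamma> t * d t) * (\<gamma> t * (1 + \<sigma>\<^sup>2 * \<alpha> t)) \<le> 2 * (lam t * \<gamma> t * d t) * (2 * \<beta>)"
      using pos gamma_le[OF t] by (intro mult_left_mono) auto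
    finally have 1: "lam t * (\<gamma> t)\<^sup>2 * (1 + \<sigma>\<^sup>2 * \<alpha> t) * (\<integral>\<omega>. (norm (B (w t \<omega>)))\<^sup>2 \<partial>M)
        \<le> 4 * \<beta> * (lam t * \<gamma> t * d t) + lam t * (\<gamma> t)\<^sup>2 * (1 + \<sigma>\<^sup>2 * \<alpha> t) * (2 * (norm (B v))\<^sup>2)"
      by (simp add: mult_ac)
    have "(1 + \<sigma>\<^sup>2 * \<alpha> t) * (2 * (norm (B v))\<^sup>2) + \<sigma>\<^sup>2
        \<le> (2 * (norm (B v))\<^sup>2 + 2 * \<sigma>\<^sup>2) * (1 + 2 * \<alpha> t * (norm (B v))\<^sup>2)"
    proof -
      have "0 \<le> \<sigma>\<^sup>2 * \<alpha> t * (norm (B v))\<^sup>2" "0 \<le> \<alpha> t * (norm (B v))\<^sup>2 * (norm (B v))\<^sup>2"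
        using pos by (auto intro!: mult_nonneg_nonneg)
      then show ?thesis by (simp add: algebra_simps)
    qed
    then have "lam t * (\<gamma> t)\<^sup>2 * ((1 + \<sigma>\<^sup>2 * \<alpha> t) * (2 * (norm (B v))\<^sup>2) + \<sigma>\<^sup>2)
        \<le> lam t * (\<gamma> t)\<^sup>2 * ((2 * (norm (B v))\<^sup>2 + 2 * \<sigma>\<^sup>2) * (1 + 2 * \<alpha> t * (norm (B v))\<^sup>2))"
      using pos by (intro mult_left_mono) auto
    then show ?thesis using 1 by (simp add: q_def algebra_simps)
  qed
  have "noise_budget n \<le> 1/2 * (4 * \<beta> * ((r 1 + \<sigma>\<^sup>2 * Q) / (\<epsilon> * \<beta>))
      + (2 * (norm (B v))\<^sup>2 + 2 * \<sigma>\<^sup>2) * Q)" for n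
  proof -
    have "noise_budget n \<le> 1/2 * (\<Sum>t=1..n. 4 * \<beta> * (lam t * \<gamma> t * d t)
        + (2 * (norm (B v))\<^sup>2 + 2 * \<sigma>\<^sup>2) * q t)"
      unfolding noise_budget_def by (intro mult_left_mono sum_mono term_le) auto
    also have "\<dots> = 1/2 * (4 * \<beta> * (\<Sum>t=1..n. lam t * \<gamma> t * d t)
        + (2 * (norm (B v))\<^sup>2 + 2 * \<sigma>\<^sup>2) * (\<Sum>t=1..n. q t))"
      by (simp only: sum.distrib sum_distrib_left)
    also have "\<dots> \<le> 1/2 * (4 * \<beta> * ((r 1 + \<sigma>\<^sup>2 * Q) / (\<epsilon> * \<beta>))
      + (2 * (norm (B v))\<^sup>2 + 2 * \<sigma>\<^sup>2) * Q)"
      using beta_pos by (intro mult_left_mono add_mono sum_d Q) auto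
    finally show ?thesis .
  qed
  then show thesis by (rule that)
qed

section \<open>The rate of convergence\<close>

lemma gap_rate:
  assumes v: "vi_solution B C v"
    and summable: "(\<lambda>t. lam t * (\<gamma> t)\<^sup>2 * (1 + 2 * \<alpha> t * (norm (B v))\<^sup>2)) summable_on {1..}"
  obtains K where "\<And>n. (\<Sum>t=1..n. \<gamma> t * lam t) > 0 \<Longrightarrow>
    \<bar>vi_gap B C (mean_average n)\<bar> \<le> K / (\<Sum>t=1..n. \<gamma> t * lam t)"
proof -
  obtain N where N: "\<And>n. noise_budget n \<le> N"
    using noise_budget_bounded[OF v summable] by blast
  obtain L where L: "L > 0" "\<And>x. vi_gap B C x \<ge> - L * norm (x - projection_onto C x)"
    using gap_ge_neg_distance by blast
  obtain D where D: "\<And>n. (\<Sum>t=1..n. \<gamma> t * lam t) > 0 \<Longrightarrow>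
    (\<Sum>t=1..n. \<gamma> t * lam t) * norm (mean_average n - projection_onto C (mean_average n)) \<le> D"
    using mean_average_near_C by blast
  have "\<bar>vi_gap B C (mean_average n)\<bar> \<le> max (initial_budget + N) (L * D) / (\<Sum>t=1..n. \<gamma> t * lam t)"
    if S: "(\<Sum>t=1..n. \<gamma> t * lam t) > 0" for n
  proof -
    let ?S = "\<Sum>t=1..n. \<gamma> t * lam t" and ?m = "mean_average n"
    have "vi_gap B C ?m * ?S \<le> initial_budget + N"
      using gap_upper_bound[OF S] N[of n] S by (simp add: pos_le_divide_eq)
    moreover have "- vi_gap B C ?m * ?S \<le> L * D"
    proof -
      have "- vi_gap B C ?m * ?S \<le> L * norm (?m - projection_onto C ?m) * ?S"
        using L(2)[of ?m] S by (intro mult_right_mono) auto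
      also have "\<dots> = L * (?S * norm (?m - projection_onto C ?m))" by simp
      also have "\<dots> \<le> L * D" using L(1) D[OF S] by (intro mult_left_mono) auto
      finally show ?thesis .
    qed
    ultimately have "\<bar>vi_gap B C ?m\<bar> * ?S \<le> max (initial_budget + N) (L * D)"
      by (auto simp: abs_if)
    then show ?thesis using S by (simp add: pos_le_divide_eq)
  qed
  then show thesis by (rule that)
qed

end

text \<open>Each of the \<open>n\<close> terms is at least the last one.\<close>
lemma sum_powr_ge:
  assumes "\<theta> \<ge> (0::real)"
  shows "(\<Sum>t=1..n. real t powr (- \<theta>)) \<ge> real n powr (1 - \<theta>)"
proof (cases "n = 0")
  case False
  have "real n powr (1 - \<theta>) = (\<Sum>t=1..n. real n powr (- \<theta>))"
    using False by (simp add: powr_diff powr_minus divide_inverse)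
  also have "\<dots> \<le> (\<Sum>t=1..n. real t powr (- \<theta>))"
    using assms by (intro sum_mono powr_mono2') auto
  finally show ?thesis .
qed simp

theorem theorem4p6:
  fixes M :: "'b measure"
    and B :: "'a::{real_inner, complete_space} \<Rightarrow> 'a"
    and C :: "'a set"
    and \<beta> \<sigma> \<epsilon> \<theta>\<^sub>0 :: real
    and \<gamma> lam \<alpha> \<theta>\<^sub>1 :: "nat \<Rightarrow> real"
    and \<BB> w z y wbar :: "nat \<Rightarrow> 'b \<Rightarrow> 'a"
  assumes "prob_space M"
    and "\<beta> > 0" and "cocoercive \<beta> B"
    and "C \<noteq> {}" and "bounded C" and "closed C" and "convex C"
    and "\<exists>v. vi_solution B C v"
    and "\<forall>t\<ge>1. \<gamma> t > 0"
    and "\<forall>t\<ge>1. 0 \<le> lam t \<and> lam t \<le> 1"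
    and "\<forall>t\<ge>1. bochner_integrable M (\<BB> t) \<and> integrable M (\<lambda>\<omega>. (norm (\<BB> t \<omega>))\<^sup>2)"
    and "strongly_measurable M (w 1)" and "integrable M (\<lambda>\<omega>. (norm (w 1 \<omega>))\<^sup>2)"
    and "\<forall>t\<ge>1. \<forall>\<omega>\<in>space M. z t \<omega> = w t \<omega> - \<gamma> t *\<^sub>R \<BB> t \<omega>"
    and "\<forall>t\<ge>1. \<forall>\<omega>\<in>space M. y t \<omega> = projection_onto C (z t \<omega>)"
    and "\<forall>t\<ge>1. \<forall>\<omega>\<in>space M. w (t + 1) \<omega> = (1 - lam t) *\<^sub>R w t \<omega> + lam t *\<^sub>R y t \<omega>"
    and "\<forall>n\<ge>1. \<forall>\<omega>\<in>space M.
      wbar n \<omega> = (\<Sum>t=1..n. (\<gamma> t * lam t) *\<^sub>R w t \<omega>) /\<^sub>R (\<Sum>t=1..n. \<gamma> t * lam t)"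
    and "\<forall>t\<ge>1. \<alpha> t > 0" and "\<sigma> > 0" and "\<epsilon> > 0"
    and "\<forall>t\<ge>1. is_cond_expectation M (generated_algebra M w t) (\<BB> t) (\<lambda>\<omega>. B (w t \<omega>))"
    and "\<forall>t\<ge>1. AE \<omega> in M.
      real_cond_exp M (generated_algebra M w t) (\<lambda>\<omega>'. (norm (\<BB> t \<omega>' - B (w t \<omega>')))\<^sup>2) \<omega>
        \<le> \<sigma>\<^sup>2 * (1 + \<alpha> t * (norm (B (w t \<omega>)))\<^sup>2)"
    and "\<forall>t\<ge>1. \<gamma> t \<le> (2 - \<epsilon>) * \<beta> / (1 + 2 * \<sigma>\<^sup>2 * \<alpha> t)"
    and "\<theta>\<^sub>0 = (SUP u\<in>C. 1/2 * (\<integral>\<omega>. (norm (w 1 \<omega> - u))\<^sup>2 \<partial>M))"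
    and "\<forall>n\<ge>1. \<theta>\<^sub>1 n = 1/2 * (\<Sum>t=1..n.
      lam t * (\<gamma> t)\<^sup>2 * (1 + \<sigma>\<^sup>2 * \<alpha> t) * (\<integral>\<omega>. (norm (B (w t \<omega>)))\<^sup>2 \<partial>M)
        + \<sigma>\<^sup>2 * lam t * (\<gamma> t)\<^sup>2)"
  shows "(\<forall>n\<ge>1. (\<Sum>t=1..n. \<gamma> t * lam t) > 0 \<longrightarrow>
           vi_gap B C (bochner_expectation M (wbar n))
             \<le> (\<theta>\<^sub>0 + \<theta>\<^sub>1 n) * inverse (\<Sum>t=1..n. lam t * \<gamma> t))
       \<and> (\<forall>v. vi_solution B C v
           \<and> filterlim (\<lambda>n. \<Sum>t=1..n. lam t * \<gamma> t) at_top sequentially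
           \<and> (\<lambda>t. lam t * (\<gamma> t)\<^sup>2 * (1 + 2 * \<alpha> t * (norm (B v))\<^sup>2)) summable_on {1..}
           \<longrightarrow> (\<lambda>n. vi_gap B C (bochner_expectation M (wbar n))) \<longlonglongrightarrow> 0
             \<and> (\<forall>\<theta>. 1/2 < \<theta> \<and> \<theta> < 1 \<and> (\<forall>t\<ge>1. lam t = 1 \<and> \<gamma> t = real t powr (- \<theta>))
                 \<longrightarrow> (\<lambda>n. vi_gap B C (bochner_expectation M (wbar n)))
                       \<in> O(\<lambda>n. real n powr (\<theta> - 1))))"
proof -
  interpret stochastic_projection_method M B C \<beta> \<sigma> \<epsilon> \<gamma> lam \<alpha> \<BB> w
    using assms(1)
  proof (intro stochastic_projection_method.intro stochastic_projection_method_axioms.intro)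
    fix t :: nat assume t: "t \<ge> 1"
    show "square_integrable M (\<BB> t)"
      using assms(11) t strongly_measurable_if_bochner_integrable
      unfolding square_integrable_def by blast
    show "w (Suc t) \<omega> =
        (1 - lam t) *\<^sub>R w t \<omega> + lam t *\<^sub>R projection_onto C (w t \<omega> - \<gamma> t *\<^sub>R \<BB> t \<omega>)"
      if "\<omega> \<in> space M" for \<omega>
      using assms(14-16) t that by simp
  next
    show "square_integrable M (w 1)"
      using assms(12,13) unfolding square_integrable_def by blast
  qed (use assms in auto)
  let ?S = "\<lambda>n. \<Sum>t=1..n. \<gamma> t * lam t"
  have S_eq: "(\<Sum>t=1..n. lam t * \<gamma> t) = ?S n" for n
    by (simp add: mult.commute)
  have mean: "bochner_expectation M (wbar n) = mean_average n" if "n \<ge> 1" for n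
    unfolding mean_average_def using assms(17) that by (intro bochner_expectation_cong) auto
  have upper: "vi_gap B C (bochner_expectation M (wbar n))
      \<le> (\<theta>\<^sub>0 + \<theta>\<^sub>1 n) * inverse (\<Sum>t=1..n. lam t * \<gamma> t)"
    if "n \<ge> 1" "?S n > 0" for n
  proof -
    have "\<theta>\<^sub>0 = initial_budget" "\<theta>\<^sub>1 n = noise_budget n"
      unfolding initial_budget_def noise_budget_def using assms(24,25) that by auto
    then show ?thesis
      using gap_upper_bound[OF that(2)] unfolding S_eq mean[OF that(1)] divide_inverse by simp
  qed
  have rate: "(\<lambda>n. vi_gap B C (bochner_expectation M (wbar n))) \<longlonglongrightarrow> 0
      \<and> (\<forall>\<theta>. 1/2 < \<theta> \<and> \<theta> < 1 \<and> (\<forall>t\<ge>1. lam t = 1 \<and> \<gamma> t = real t powr (- \<theta>))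
          \<longrightarrow> (\<lambda>n. vi_gap B C (bochner_expectation M (wbar n))) \<in> O(\<lambda>n. real n powr (\<theta> - 1)))"
    if v: "vi_solution B C v"
      and div: "filterlim (\<lambda>n. \<Sum>t=1..n. lam t * \<gamma> t) at_top sequentially"
      and summable: "(\<lambda>t. lam t * (\<gamma> t)\<^sup>2 * (1 + 2 * \<alpha> t * (norm (B v))\<^sup>2)) summable_on {1..}" for v
  proof -
    let ?V = "\<lambda>n. vi_gap B C (bochner_expectation M (wbar n))"
    obtain K where K: "\<And>n. ?S n > 0 \<Longrightarrow> \<bar>vi_gap B C (mean_average n)\<bar> \<le> K / ?S n"
      using gap_rate[OF v summable] by blast
    have ev: "eventually (\<lambda>n. n \<ge> 1 \<and> ?S n > 0) sequentially"
      using div unfolding S_eq filterlim_at_top_dense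
      by (intro eventually_conj eventually_ge_at_top) auto
    have "?V \<longlonglongrightarrow> 0"
    proof (rule Lim_null_comparison)
      show "eventually (\<lambda>n. norm (?V n) \<le> K / ?S n) sequentially"
        using ev by eventually_elim (use mean K in auto)
      show "(\<lambda>n. K / ?S n) \<longlonglongrightarrow> 0"
        using div unfolding S_eq
        by (intro tendsto_divide_0[OF tendsto_const] filterlim_at_top_imp_at_infinity)
    qed
    moreover have "?V \<in> O(\<lambda>n. real n powr (\<theta> - 1))"
      if \<theta>: "1/2 < \<theta>" "\<theta> < 1" "\<forall>t\<ge>1. lam t = 1 \<and> \<gamma> t = real t powr (- \<theta>)" for \<theta>
    proof (rule bigoI)
      show "eventually (\<lambda>n. norm (?V n) \<le> \<bar>K\<bar> * norm (real n powr (\<theta> - 1))) sequentially"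
        using ev
      proof eventually_elim
        case (elim n)
        have "real n powr (1 - \<theta>) \<le> ?S n"
          using sum_powr_ge[of \<theta> n] \<theta> by simp
        have "norm (?V n) \<le> K / ?S n"
          using K mean elim by simp
        also have "\<dots> \<le> \<bar>K\<bar> / ?S n"
          using elim by (intro divide_right_mono) auto
        also have "\<dots> \<le> \<bar>K\<bar> / real n powr (1 - \<theta>)"
          using elim \<open>real n powr (1 - \<theta>) \<le> ?S n\<close> by (intro divide_left_mono) auto
        also have "\<dots> = \<bar>K\<bar> * norm (real n powr (\<theta> - 1))"
          using powr_minus_divide[of "real n" "1 - \<theta>"] by simp
        finally show ?case .
      qed
    qed
    ultimately show ?thesis by blast
  qed
  show ?thesis
    using upper rate by blast
qed

end
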